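(* There is a canonical bijection between $2$-triangulations on the half-cylinder $\mathcal{C}_n$ with $n$ marked points and $n$-periodic $2$-triangulations on the $4n$-gon.
   Context: Here $n\ge 1$ is an integer. **Half-cylinder and universal cover.** $\mathcal{C}_n$ is the annulus with $n$ marked points on one of its boundary components (and none on the other). Its universal cover $\overline{\mathcal{C}}_n$ has vertices $\alpha_i$, $i\in\mathbb{Z}$ (the lifts of the marked points, in order along the boundary line); the covering map $\pi$ sends $\alpha_i$ to the marked point indexed by $i \bmod n$. An edge of $\overline{\mathcal{C}}_n$ is an isotopy class of curves joining two distinct vertices $\alpha_i,\alpha_j$; it is determined by the unordered pair and denoted $[\alpha_i,\alpha_j]$. Its length is $|j-i|$. A translation of $[\alpha_i,\alpha_j]$ is an edge $[\alpha_{i+\ell n},\alpha_{j+\ell n}]$ with $\ell\in\mathbb{Z}$. An edge of $\mathcal{C}_n$ is a projection $\pi(e)$ of an edge $e$ of $\overline{\mathcal{C}}_n$, with $\pi(e)=\pi(f)$ if and only if $f$ is a translation of $e$; the length of $\pi(e)$ is the length of $e$. Two edges of $\overline{\mathcal{C}}_n$ intersect if and only if they can be written $[\alpha_{a_1},\alpha_{b_1}]$, $[\alpha_{a_2},\alpha_{b_2}]$ with $a_1<a_2<b_1<b_2$. A $3$-crossing is a set of three pairwise intersecting edges. **$2$-triangulations on $\mathcal{C}_n$.** A $2$-triangulation on $\mathcal{C}_n$ is an inclusion-maximal set $T$ of edges of $\mathcal{C}_n$ such that $\pi^{-1}(T)$ contains no $3$-crossing. **$2$-triangulations on the $4n$-gon.**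 A $2$-triangulation on the convex $4n$-gon is an inclusion-maximal set of edges (namely, internal diagonals) such that no three of them mutually intersect inside the polygon. It is $n$-periodic if it is invariant under rotation by $\pi/2$ radians (here $\pi$ is the number). **Convention.** When discussing $2$-triangulations on $\mathcal{C}_n$, all edges of length $<2$ (which never occur in a $3$-crossing) are excluded. *)

theory Defs
  imports "HOL-Analysis.Analysis"
begin

section \<open>Maximal edge sets without 3-crossings\<close>

definition no_3_crossing :: "('e \<Rightarrow> 'e \<Rightarrow> bool) \<Rightarrow> 'e set \<Rightarrow> bool" where
  "no_3_crossing R E \<longleftrightarrow> \<not> (\<exists>S \<subseteq> E. card S = 3 \<and> pairwise R S)"

definition inclusion_maximal :: "('e set \<Rightarrow> bool) \<Rightarrow> 'e set \<Rightarrow> bool" where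
  "inclusion_maximal P T \<longleftrightarrow> P T \<and> (\<forall>U. P U \<and> T \<subseteq> U \<longrightarrow> U = T)"

section \<open>The half-cylinder with \<open>n\<close> marked points\<close>

text \<open>
  The vertex \<open>\<alpha>\<^sub>i\<close> of the universal cover is represented by the integer \<open>i\<close>, and
  the edge \<open>[\<alpha>\<^sub>i, \<alpha>\<^sub>j]\<close> by the unordered pair \<open>{i, j}\<close>.
\<close>

definition cover_edges :: "int set set" where
  "cover_edges = {{i, j} | i j. i \<noteq> j}"

text \<open>For \<open>e = {i, j}\<close> this is \<open>\<bar>j - i\<bar>\<close>.\<close>

definition edge_length :: "int set \<Rightarrow> int" where
  "edge_length e = Max e - Min e"

definition translate :: "nat \<Rightarrow> int \<Rightarrow> int set \<Rightarrow> int set" where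
  "translate n l e = (\<lambda>i. i + l * int n) ` e"

text \<open>An edge of the half-cylinder is the class of all translations of an edge of the cover.\<close>

definition proj_edge :: "nat \<Rightarrow> int set \<Rightarrow> int set set" where
  "proj_edge n e = {translate n l e | l. True}"

text \<open>Edges of length less than 2 are excluded throughout.\<close>

definition cyl_edges :: "nat \<Rightarrow> int set set set" where
  "cyl_edges n = proj_edge n ` {e \<in> cover_edges. edge_length e \<ge> 2}"

definition preimage_edges :: "nat \<Rightarrow> int set set set \<Rightarrow> int set set" where
  "preimage_edges n T = {e \<in> cover_edges. proj_edge n e \<in> T}"

definition cover_intersect :: "int set \<Rightarrow> int set \<Rightarrow> bool" where
  "cover_intersect e f \<longleftrightarrow>
     (\<exists>a1 a2 b1 b2. a1 < a2 \<and> a2 < b1 \<and> b1 < b2 \<and> {e, f} = {{a1, b1}, {a2, b2}})"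

definition cyl_2_triangulation :: "nat \<Rightarrow> int set set set \<Rightarrow> bool" where
  "cyl_2_triangulation n =
     inclusion_maximal
       (\<lambda>T. T \<subseteq> cyl_edges n \<and> no_3_crossing cover_intersect (preimage_edges n T))"

section \<open>The convex polygon\<close>

text \<open>
  The convex \<open>m\<close>-gon is the regular one inscribed in the unit circle, so that rotations act
  on it; a diagonal is represented by the set of its two end points.  The vertices are indexed
  by all integers, periodically modulo \<open>m\<close>.
\<close>

definition vertex :: "nat \<Rightarrow> int \<Rightarrow> complex" where
  "vertex m i = cis (2 * pi * real_of_int i / real m)"

definition polygon_sides :: "nat \<Rightarrow> complex set set" where
  "polygon_sides m = {{vertex m i, vertex m (i + 1)} | i. True}"

definition polygon_diagonals :: "nat \<Rightarrow> complex set set" where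
  "polygon_diagonals m =
     {{u, v} | u v. u \<in> range (vertex m) \<and> v \<in> range (vertex m) \<and> u \<noteq> v} - polygon_sides m"

text \<open>
  Open segments are used since diagonals that only share an end point do not intersect inside
  the polygon.  (A diagonal intersects itself in this sense, but only pairs of distinct
  diagonals are considered, through \<^const>\<open>pairwise\<close>.)
\<close>

definition diagonals_intersect :: "complex set \<Rightarrow> complex set \<Rightarrow> bool" where
  "diagonals_intersect d e \<longleftrightarrow>
     (\<exists>u v w x. d = {u, v} \<and> e = {w, x} \<and> open_segment u v \<inter> open_segment w x \<noteq> {})"

definition polygon_2_triangulation :: "nat \<Rightarrow> complex set set \<Rightarrow> bool" where
  "polygon_2_triangulation m =
     inclusion_maximal
       (\<lambda>D. D \<subseteq> polygon_diagonals m \<and> no_3_crossing diagonals_intersect D)"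

definition quarter_turn_invariant :: "complex set set \<Rightarrow> bool" where
  "quarter_turn_invariant D \<longleftrightarrow> (\<lambda>d. (\<lambda>z. cis (pi / 2) * z) ` d) ` D = D"

section \<open>The canonical map\<close>

text \<open>
  The line of vertices of the cover is wrapped around the \<open>4n\<close>-gon by sending
  \<open>\<alpha>\<^sub>i\<close> to the \<open>i\<close>-th vertex; a set of edges of the half-cylinder is sent to the set
  of diagonals that are images of its lifts.
\<close>

definition canonical_map :: "nat \<Rightarrow> int set set set \<Rightarrow> complex set set" where
  "canonical_map n T = (\<lambda>e. vertex (4 * n) ` e) ` preimage_edges n T"

end

theory Submission
  imports Defs
begin

text \<open>
  Wrapping the line around the \<open>4n\<close>-gon identifies the edges of the half-cylinder of length
  between \<open>2\<close> and \<open>2n\<close> with the orbits of diagonals under the quarter turn; longer edges cross two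
  of their own translations.  A 3-crossing in the cover clearly maps to one in the polygon.
  Conversely, a 3-crossing in the polygon either lifts directly, or its three short arcs cross only
  cyclically; then the longest arc, its translation by \<open>n\<close> and a translation of one of the other two
  form a 3-crossing in the cover.

  It remains to see that a set \<open>D\<close> which is maximal among the invariant sets without 3-crossing is
  maximal among all sets without 3-crossing.  Otherwise let \<open>{a, b}\<close> be a longest diagonal outside
  \<open>D\<close> that can be added alone.  Adding its whole orbit creates a 3-crossing, so some diagonal of \<open>D\<close>
  crosses both \<open>{a, b}\<close> and \<open>{a + n, b + n}\<close>; let \<open>{c, d}\<close> be a longest one, where
  \<open>a < c < a + n < b < d \<le> c + n\<close>.  Then \<open>{a, d}\<close> and \<open>{c - n, b}\<close> can also be added, and
  they are longer than \<open>{a, b}\<close>, so they are in \<open>D\<close>.  But now \<open>{a, d}\<close>, \<open>{c, b + n}\<close> and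
  \<open>{a + n, d + n}\<close> form a 3-crossing in \<open>D\<close>.
\<close>

section \<open>Chords of a periodic polygon\<close>

text \<open>Three pairwise crossing chords have six distinct end points, and each chord joins
  opposite ones in the cyclic order; the circle is cut open at \<open>p1\<close>.\<close>

definition polygon_3_crossing :: "int \<Rightarrow> (int \<Rightarrow> int \<Rightarrow> bool) \<Rightarrow> bool" where
  "polygon_3_crossing N E \<longleftrightarrow>
     (\<exists>p1 p2 p3 p4 p5 p6. p1 < p2 \<and> p2 < p3 \<and> p3 < p4 \<and> p4 < p5 \<and> p5 < p6 \<and> p6 < p1 + N
        \<and> E p1 p4 \<and> E p2 p5 \<and> E p3 p6)"

definition cover_3_crossing :: "(int \<Rightarrow> int \<Rightarrow> bool) \<Rightarrow> bool" where
  "cover_3_crossing E \<longleftrightarrow>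
     (\<exists>a1 a2 a3 b1 b2 b3. a1 < a2 \<and> a2 < a3 \<and> a3 < b1 \<and> b1 < b2 \<and> b2 < b3
        \<and> E a1 b1 \<and> E a2 b2 \<and> E a3 b3)"

lemma cover_3_crossingI:
  "\<lbrakk>E a1 b1; E a2 b2; E a3 b3; a1 < a2; a2 < a3; a3 < b1; b1 < b2; b2 < b3\<rbrakk> \<Longrightarrow> cover_3_crossing E"
  unfolding cover_3_crossing_def by blast

lemma polygon_3_crossingI:
  "\<lbrakk>E p1 p4; E p2 p5; E p3 p6; p1 < p2; p2 < p3; p3 < p4; p4 < p5; p5 < p6; p6 < p1 + N\<rbrakk>
   \<Longrightarrow> polygon_3_crossing N E"
  unfolding polygon_3_crossing_def by blast

text \<open>The vertices of the \<open>4n\<close>-gon are the integers modulo \<open>4n\<close>, and \<open>E x y\<close> says that the chord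
  joining \<open>x\<close> and \<open>y\<close> is present.\<close>

locale quarter_periodic =
  fixes n :: int and E :: "int \<Rightarrow> int \<Rightarrow> bool"
  assumes n_pos: "n > 0"
    and sym: "E x y \<Longrightarrow> E y x"
    and period: "E (x + 4 * n) y \<longleftrightarrow> E x y"
    and turn: "E (x + n) (y + n) \<longleftrightarrow> E x y"
begin

lemma period': "E x (y + 4 * n) \<longleftrightarrow> E x y"
  using sym period by blast

lemma turn_int: "E (x + k * n) (y + k * n) \<longleftrightarrow> E x y"
proof (induction k rule: int_induct[where k = 0])
  case (step1 i)
  then show ?case using turn[of "x + i * n" "y + i * n"] by (simp add: algebra_simps)
next
  case (step2 i)
  then show ?case using turn[of "x + (i - 1) * n" "y + (i - 1) * n"] by (simp add: algebra_simps)
qed simp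

lemma turn_back: "E (x - n) (y - n) \<longleftrightarrow> E x y" "E (x - 2 * n) (y - 2 * n) \<longleftrightarrow> E x y"
  using turn_int[of x "-1" y] turn_int[of x "-2" y] by (simp_all add: algebra_simps)

section \<open>Short arcs: 3-crossings in the polygon and in the cover\<close>

definition short :: "int \<Rightarrow> int \<Rightarrow> bool" where
  "short x y \<longleftrightarrow> E x y \<and> y - x \<le> 2 * n"

lemma short_turn: "short (x + n) (y + n) \<longleftrightarrow> short x y" "short (x - n) (y - n) \<longleftrightarrow> short x y"
  "short (x - 2 * n) (y - 2 * n) \<longleftrightarrow> short x y"
  by (simp_all add: short_def turn turn_back)

lemma short_period: "short (x + 4 * n) (y + 4 * n) \<longleftrightarrow> short x y"
  by (simp add: short_def period period')

text \<open>Three short arcs that only cross cyclically: the longest one crosses its own quarter turn,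
  and one of the others, suitably turned, crosses both.\<close>

lemma cover_3_crossing_cyclic_longest:
  assumes A: "short x1 y1" and B: "short x2 y2" and C: "short x3 y3"
    and ord: "x1 < x2" "x2 < y1" "y1 < x3" "x3 < y2" "y2 < x1 + 4 * n" "x1 + 4 * n < y3"
       "y3 < x2 + 4 * n"
    and longest: "y2 - x2 \<le> y1 - x1" "y3 - x3 \<le> y1 - x1"
  shows "cover_3_crossing short"
proof (rule ccontr)
  assume no: "\<not> ?thesis"
  have le: "y1 - x1 \<le> 2 * n" "y2 - x2 \<le> 2 * n" "y3 - x3 \<le> 2 * n"
    using A B C by (auto simp: short_def)
  \<comment> \<open>The arcs wind once around the circle with overlaps, so their lengths add up to
    more than \<open>4 * n\<close>.\<close>
  have gt: "y1 - x1 > n" using ord longest by linarith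
  \<comment> \<open>A counterexample would start strictly between \<open>x1\<close> and
    \<open>x1 + n\<close> and end strictly between \<open>y1\<close> and \<open>y1 + n\<close>,
    hence cross both the longest arc and its quarter turn.\<close>
  have nested: "d \<le> y1" if "short c d" "x1 \<le> c" "c < x1 + n" "d - c \<le> y1 - x1" for c d
  proof (rule ccontr)
    assume "\<not> d \<le> y1"
    with that gt A no show False
      using cover_3_crossingI[of short x1 y1 c d "x1 + n" "y1 + n"] by (auto simp: short_turn)
  qed
  have "x2 \<ge> x1 + n" using nested[OF B] ord longest by linarith
  then have "y2 - n \<le> y1" using nested[of "x2 - n" "y2 - n"] B ord longest le
    by (simp add: short_turn)
  then have "x3 < x1 + 3 * n" using ord le by linarith
  show False
  \<comment> \<open>Turned back by one or two quarters, the third arc starts in the quarter after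
    \<open>x1\<close>. Then \<open>nested\<close> bounds \<open>y3\<close> by
    \<open>y1 + 2 * n\<close>, which is at most \<open>x1 + 4 * n\<close>.\<close>
  proof (cases "x3 < x1 + 2 * n")
    case True
    then have "y3 - n \<le> y1" using nested[of "x3 - n" "y3 - n"] C ord longest le gt
      by (simp add: short_turn)
    then show False using ord le n_pos by linarith
  next
    case False
    then have "y3 - 2 * n \<le> y1" using nested[of "x3 - 2 * n" "y3 - 2 * n"] C ord longest le gt
       \<open>x3 < x1 + 3 * n\<close> by (simp add: short_turn)
    then show False using ord le by linarith
  qed
qed

text \<open>Moving the first arc to the end, raised by \<open>4 * n\<close>, preserves the
  configuration, so the longest arc may be taken first.\<close>

lemma cover_3_crossing_cyclic:
  assumes A: "short x1 y1" and B: "short x2 y2" and C: "short x3 y3"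
    and ord: "x1 < x2" "x2 < y1" "y1 < x3" "x3 < y2" "y2 < x1 + 4 * n" "x1 + 4 * n < y3"
       "y3 < x2 + 4 * n"
  shows "cover_3_crossing short"
proof -
  consider "y2 - x2 \<le> y1 - x1" "y3 - x3 \<le> y1 - x1" | "y1 - x1 \<le> y2 - x2" "y3 - x3 \<le> y2 - x2"
    | "y1 - x1 \<le> y3 - x3" "y2 - x2 \<le> y3 - x3" by linarith
  then show ?thesis
  proof cases
    case 1
    then show ?thesis using cover_3_crossing_cyclic_longest[OF A B C ord] by blast
  next
    case 2
    then show ?thesis
      using cover_3_crossing_cyclic_longest[of x2 y2 x3 y3 "x1 + 4 * n" "y1 + 4 * n"] A B C ord
      by (simp add: short_period)
  next
    case 3
    then show ?thesis
      using cover_3_crossing_cyclic_longest[of x3 y3 "x1 + 4 * n" "y1 + 4 * n" "x2 + 4 * n" "y2 + 4 * n"]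
        A B C ord by (simp add: short_period)
  qed
qed

text \<open>The two arcs of a chord have lengths adding up to \<open>4 * n\<close>, so one of them
  is at most \<open>2 * n\<close>; for a diameter both are.\<close>

lemma short_cases:
  assumes "E x y"
  shows "short x y \<or> short y (x + 4 * n)"
  using assms sym[of x y] by (auto simp: short_def period')

text \<open>From the cover to the polygon, short lengths give
  \<open>b3 < b1 + 2 * n \<le> a1 + 4 * n\<close>, so all end points fit in one window. Conversely,
  each chord has a short arc on one of its two sides: six of the eight choices cross linearly after
  a shift by \<open>4 * n\<close>, and the two alternating ones are cyclic.\<close>

lemma cover_3_crossing_iff: "cover_3_crossing (\<lambda>x y. short x y) \<longleftrightarrow> polygon_3_crossing (4 * n) E"
proof
  assume "cover_3_crossing (\<lambda>x y. short x y)"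
  then obtain a1 a2 a3 b1 b2 b3 where ord: "a1 < a2" "a2 < a3" "a3 < b1" "b1 < b2" "b2 < b3"
    and s: "short a1 b1" "short a2 b2" "short a3 b3"
    unfolding cover_3_crossing_def by blast
  then have E: "E a1 b1" "E a2 b2" "E a3 b3"
    and le: "b1 - a1 \<le> 2 * n" "b2 - a2 \<le> 2 * n" "b3 - a3 \<le> 2 * n"
    by (auto simp: short_def)
  show "polygon_3_crossing (4 * n) E"
    by (rule polygon_3_crossingI[of E, OF E]) (use ord le in linarith)+
next
  assume "polygon_3_crossing (4 * n) E"
  then obtain p1 p2 p3 p4 p5 p6 where ord: "p1 < p2" "p2 < p3" "p3 < p4" "p4 < p5" "p5 < p6"
      "p6 < p1 + 4 * n" and E: "E p1 p4" "E p2 p5" "E p3 p6"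
    unfolding polygon_3_crossing_def by blast
  note S = short_cases[OF E(1)] short_cases[OF E(2)] short_cases[OF E(3)]
  note I = cover_3_crossingI[of short]
  consider
      "short p1 p4" "short p2 p5" "short p3 p6"
    | "short p1 p4" "short p2 p5" "short p6 (p3 + 4 * n)"
    | "short p1 p4" "short p5 (p2 + 4 * n)" "short p3 p6"
    | "short p1 p4" "short p5 (p2 + 4 * n)" "short p6 (p3 + 4 * n)"
    | "short p4 (p1 + 4 * n)" "short p2 p5" "short p3 p6"
    | "short p4 (p1 + 4 * n)" "short p2 p5" "short p6 (p3 + 4 * n)"
    | "short p4 (p1 + 4 * n)" "short p5 (p2 + 4 * n)" "short p3 p6"
    | "short p4 (p1 + 4 * n)" "short p5 (p2 + 4 * n)" "short p6 (p3 + 4 * n)"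
    using S by blast
  then show "cover_3_crossing (\<lambda>x y. short x y)"
  proof cases
    case 1
    then show ?thesis using I[of p1 p4 p2 p5 p3 p6] ord by simp
  next
    case 2
    then show ?thesis using I[of p6 "p3 + 4 * n" "p1 + 4 * n" "p4 + 4 * n" "p2 + 4 * n" "p5 + 4 * n"] ord
      by (simp add: short_period)
  next
    case 3
    then show ?thesis using cover_3_crossing_cyclic[of p1 p4 p3 p6 p5 "p2 + 4 * n"] ord by simp
  next
    case 4
    then show ?thesis using I[of p5 "p2 + 4 * n" p6 "p3 + 4 * n" "p1 + 4 * n" "p4 + 4 * n"] ord
      by (simp add: short_period)
  next
    case 5
    then show ?thesis using I[of p2 p5 p3 p6 p4 "p1 + 4 * n"] ord by simp
  next
    case 6
    then show ?thesis using cover_3_crossing_cyclic[of p2 p5 p4 "p1 + 4 * n" p6 "p3 + 4 * n"] ord by simp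
  next
    case 7
    then show ?thesis using I[of p3 p6 p4 "p1 + 4 * n" p5 "p2 + 4 * n"] ord by simp
  next
    case 8
    then show ?thesis using I[of p4 "p1 + 4 * n" p5 "p2 + 4 * n" p6 "p3 + 4 * n"] ord by simp
  qed
qed

section \<open>Chords that can be added without creating a 3-crossing\<close>

text \<open>Adding the chord \<open>{a, b}\<close> creates no 3-crossing. Rotating the six end points allows us to
  assume that \<open>a\<close> comes first.\<close>

definition addable :: "int \<Rightarrow> int \<Rightarrow> bool" where
  "addable a b \<longleftrightarrow>
     (\<forall>p q r s. a < p \<longrightarrow> p < q \<longrightarrow> q < b \<longrightarrow> b < r \<longrightarrow> r < s \<longrightarrow> s < a + 4 * n \<longrightarrow> E p r \<longrightarrow> E q s \<longrightarrow> False)"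

lemma addableD_first:
  "\<lbrakk>addable a b; E p r; E q s; a < p; p < q; q < b; b < r; r < s; s < a + 4 * n\<rbrakk> \<Longrightarrow> False"
  unfolding addable_def by blast

lemma addableD_middle:
  "\<lbrakk>addable a b; E p r; E q s; p < a; a < q; q < r; r < b; b < s; s < p + 4 * n\<rbrakk> \<Longrightarrow> False"
  using addableD_first[of a b q s r "p + 4 * n"] sym by (simp add: period')

lemma addableD_last:
  "\<lbrakk>addable a b; E p r; E q s; p < q; q < a; a < r; r < s; s < b; b < p + 4 * n\<rbrakk> \<Longrightarrow> False"
  using addableD_first[of a b r "p + 4 * n" s "q + 4 * n"] sym by (simp add: period')

lemma addable_turn: "addable a b \<Longrightarrow> addable (a + n) (b + n)"
  unfolding addable_def
proof (intro allI impI, goal_cases)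
  case (1 p q r s)
  show False
    using 1(1)[rule_format, of "p - n" "q - n" "r - n" "s - n"] 1(2-) by (simp add: turn_back)
qed

text \<open>A chord of \<open>E\<close> crossing both \<open>{a, b}\<close> and its quarter turn has to be in this position when
  \<open>{a, b}\<close> is addable: otherwise it crosses its own quarter turn too.\<close>

definition obstruction :: "int \<Rightarrow> int \<Rightarrow> int \<Rightarrow> int \<Rightarrow> bool" where
  "obstruction a b c d \<longleftrightarrow> E c d \<and> a < c \<and> c < a + n \<and> b < d \<and> d \<le> c + n"

text \<open>If two chords crossed each other and \<open>{a, d}\<close>, the turns of
  \<open>{a, b}\<close> and \<open>{c, d}\<close> would confine their end points so far that
  \<open>{x2, y2}\<close> is a longer obstruction, or crosses \<open>{a, b}\<close> together with
  its own turn.\<close>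

lemma addable_extend:
  assumes add: "addable a b" and len: "n < b - a" "b - a \<le> 2 * n"
    and f: "obstruction a b c d"
    and outer: "\<And>c' d'. obstruction a b c' d' \<Longrightarrow> d' - c' \<le> d - c"
    and free: "\<not> polygon_3_crossing (4 * n) E"
  shows "addable a d"
  unfolding addable_def
proof (intro allI impI)
  fix x2 x1 y2 y1
  assume ord: "a < x2" "x2 < x1" "x1 < d" "d < y2" "y2 < y1" "y1 < a + 4 * n"
    and h2: "E x2 y2" and h1: "E x1 y1"
  have F: "E c d" "a < c" "c < a + n" "b < d" "d \<le> c + n"
    using f by (auto simp: obstruction_def)
  have Fm: "E (c - n) (d - n)" and Fp: "E (c + n) (d + n)"
    using F by (simp_all add: turn turn_back)
  note add' = addable_turn[OF add]
  have x1: "x1 \<ge> b"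
    by (rule ccontr, rule addableD_first[OF add h2 h1]) (use ord F in linarith)+
  have x2: "x2 \<le> c"
  proof (rule ccontr)
    assume "\<not> x2 \<le> c"
    then have "polygon_3_crossing (4 * n) E"
      by (intro polygon_3_crossingI[of E, OF F(1) h2 h1]) (use ord F in linarith)+
    with free show False by blast
  qed
  \<comment> \<open>This bound and the next two each exclude a 3-crossing of \<open>{a, b}\<close>
    or its turn, \<open>{c, d}\<close> or one of its turns, and one of the new chords.\<close>
  have y1: "y1 \<le> b + n"
    by (rule ccontr, rule addableD_middle[OF add' F(1) h1]) (use x1 ord F len in linarith)+
  have x2': "x2 \<ge> d - n"
    by (rule ccontr, rule addableD_middle[OF add Fm h2]) (use y1 ord F len in linarith)+
  have y2': "y2 \<le> c + n"
    by (rule ccontr, rule addableD_middle[OF add' h2 Fp]) (use y1 x2 ord F len in linarith)+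
  show False
  \<comment> \<open>At length at most \<open>n\<close> the chord is an obstruction with
    \<open>x2 \<le> c\<close> and \<open>d < y2\<close>, against the choice of
    \<open>{c, d}\<close>. Beyond \<open>n\<close> it crosses its turn back, and both cross
    \<open>{a, b}\<close>.\<close>
  proof (cases "y2 \<le> x2 + n")
    case True
    then have "obstruction a b x2 y2"
      using h2 ord x2 F by (auto simp: obstruction_def)
    then show False using outer[of x2 y2] x2 ord by linarith
  next
    case False
    have "E (x2 - n) (y2 - n)" using h2 by (simp add: turn_back)
    then show False
      by (rule addableD_middle[OF add _ h2]) (use False x2 x2' y2' ord F len in linarith)+
  qed
qed

lemma reflect: "quarter_periodic n (\<lambda>x y. E (- x) (- y))"
proof
  show "E (- (x + 4 * n)) (- y) \<longleftrightarrow> E (- x) (- y)" for x y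
    using period[of "- x - 4 * n" "- y"] by simp
  show "E (- (x + n)) (- (y + n)) \<longleftrightarrow> E (- x) (- y)" for x y
    using turn[of "- x - n" "- y - n"] by simp
qed (use n_pos sym in auto)

text \<open>This is the mirror image of \<open>addable_extend\<close>. Reflection carries
  \<open>{a, b}\<close> to \<open>{- b, - a}\<close>, but an obstruction to a chord that starts too
  early; a quarter turn then puts it at \<open>{- d + n, - c + n}\<close>.\<close>

lemma addable_extend_left:
  assumes add: "addable a b" and len: "n < b - a" "b - a \<le> 2 * n"
    and f: "obstruction a b c d"
    and outer: "\<And>c' d'. obstruction a b c' d' \<Longrightarrow> d' - c' \<le> d - c"
    and free: "\<not> polygon_3_crossing (4 * n) E"
  shows "addable (c - n) b"
proof -
  interpret R: quarter_periodic n "\<lambda>x y. E (- x) (- y)" by (rule reflect)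
  have addR: "R.addable (- v) (- u) \<longleftrightarrow> addable u v" for u v
  proof
    assume A: "addable u v"
    show "R.addable (- v) (- u)"
      unfolding R.addable_def
    proof (intro allI impI)
      fix p q r s assume o: "- v < p" "p < q" "q < - u" "- u < r" "r < s" "s < - v + 4 * n"
        and "E (- p) (- r)" "E (- q) (- s)"
      then have "E (- s) (- q)" "E (- r) (- p)" using sym by blast+
      then show False using addableD_last[OF A, of "- s" "- q" "- r" "- p"] o by linarith
    qed
  next
    assume A: "R.addable (- v) (- u)"
    show "addable u v"
      unfolding addable_def
    proof (intro allI impI)
      fix p q r s assume o: "u < p" "p < q" "q < v" "v < r" "r < s" "s < u + 4 * n"
        and "E p r" "E q s"
      then have "E (- (- s)) (- (- q))" "E (- (- r)) (- (- p))" using sym by simp_all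
      then show False using R.addableD_last[OF A, of "- s" "- q" "- r" "- p"] o by linarith
    qed
  qed
  have obR: "R.obstruction (- b) (- a) c' d' \<longleftrightarrow> obstruction a b (- d' + n) (- c' + n)" for c' d'
    using turn[of "- c'" "- d'"] sym[of "- d' + n" "- c' + n"] sym[of "- c' + n" "- d' + n"] len
    unfolding R.obstruction_def obstruction_def by (auto simp: add.commute)
  have "\<not> polygon_3_crossing (4 * n) (\<lambda>x y. E (- x) (- y))"
  proof
    assume "polygon_3_crossing (4 * n) (\<lambda>x y. E (- x) (- y))"
    then obtain p1 p2 p3 p4 p5 p6 where o: "p1 < p2" "p2 < p3" "p3 < p4" "p4 < p5" "p5 < p6"
      "p6 < p1 + 4 * n" and e: "E (- p1) (- p4)" "E (- p2) (- p5)" "E (- p3) (- p6)"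
      unfolding polygon_3_crossing_def by blast
    have "polygon_3_crossing (4 * n) E"
      by (rule polygon_3_crossingI[of E, OF sym[OF e(3)] sym[OF e(2)] sym[OF e(1)]]) (use o in linarith)+
    with free show False by blast
  qed
  moreover have "R.obstruction (- b) (- a) (- d + n) (- c + n)"
    using f by (simp add: obR)
  moreover have "d' - c' \<le> (- c + n) - (- d + n)" if "R.obstruction (- b) (- a) c' d'" for c' d'
    using outer[OF that[unfolded obR]] by linarith
  ultimately have "R.addable (- b) (- c + n)"
    using len add R.addable_extend[of "- b" "- a" "- d + n" "- c + n"] by (simp add: addR)
  then show ?thesis using addR[of b "c - n"] by simp
qed

text \<open>Turns of \<open>{a, b}\<close> must take part, since \<open>E\<close> itself is free,
  and three of them never cross pairwise. A single one contradicts addability, so exactly two occur;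
  the remaining chord then lies between them and is an obstruction up to a turn.\<close>

lemma obstruction_exists:
  assumes add: "addable a b" and len: "b - a \<le> 2 * n" "a < b"
    and free: "\<not> polygon_3_crossing (4 * n) E"
    and crossing: "cover_3_crossing (\<lambda>x y. short x y \<or> (\<exists>k. x = a + k * n \<and> y = b + k * n))"
  shows "n < b - a \<and> (\<exists>c d. obstruction a b c d)"
proof -
  define orb where "orb x y \<longleftrightarrow> (\<exists>k. x = a + k * n \<and> y = b + k * n)" for x y
  obtain a1 a2 a3 b1 b2 b3 where ord: "a1 < a2" "a2 < a3" "a3 < b1" "b1 < b2" "b2 < b3"
    and s: "short a1 b1 \<or> orb a1 b1" "short a2 b2 \<or> orb a2 b2" "short a3 b3 \<or> orb a3 b3"
    using crossing unfolding cover_3_crossing_def orb_def by blast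
  have le: "y - x \<le> 2 * n" if "short x y \<or> orb x y" for x y
    using that len by (auto simp: short_def orb_def)
  note les = le[OF s(1)] le[OF s(2)] le[OF s(3)]
  have E: "E x y" if "short x y" for x y using that by (simp add: short_def)
  \<comment> \<open>Crossing members of the orbit start less than \<open>b - a \<le> 2 * n\<close>
    apart, hence differ by one quarter turn.\<close>
  have two: "y = x + n \<and> y' = x' + n" if "orb x x'" "orb y y'" "x < y" "y < x'" for x x' y y'
  proof -
    from that obtain k l where kl: "x = a + k * n" "x' = b + k * n" "y = a + l * n" "y' = b + l * n"
      by (auto simp: orb_def)
    have "0 < (l - k) * n" "(l - k) * n < 2 * n" using kl that len by (auto simp: algebra_simps)
    then have "l = k + 1" using n_pos by (simp add: zero_less_mult_iff)
    then show ?thesis using kl by (simp add: algebra_simps)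
  qed
  have turned: "addable x y" if "orb x y" for x y
  proof -
    from that obtain k where k: "x = a + k * n" "y = b + k * n" by (auto simp: orb_def)
    have "False" if "x < p" "p < q" "q < y" "y < r" "r < s" "s < x + 4 * n" "E p r" "E q s" for p q r s
      using addableD_first[OF add, of "p - k * n" "r - k * n" "q - k * n" "s - k * n"] that
        turn_int[of "p - k * n" k "r - k * n"] turn_int[of "q - k * n" k "s - k * n"]
      by (simp add: k)
    then show ?thesis unfolding addable_def by blast
  qed
  have step: "n < b - a \<and> (\<exists>c d. obstruction a b c d)"
    if xy: "orb x y" and ob: "obstruction x y c d" and "n < y - x" for x y c d
  proof -
    from xy obtain k where k: "x = a + k * n" "y = b + k * n" by (auto simp: orb_def)
    have "obstruction a b (c - k * n) (d - k * n)"
      using ob turn_int[of "c - k * n" k "d - k * n"] unfolding obstruction_def k by auto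
    then show ?thesis using k that by auto
  qed
  have none: "\<not> (short a1 b1 \<and> short a2 b2 \<and> short a3 b3)"
    using free cover_3_crossing_iff ord cover_3_crossingI[of short] by blast
  have "\<not> (orb a1 b1 \<and> orb a2 b2 \<and> orb a3 b3)"
    using two[of a1 b1 a2 b2] two[of a2 b2 a3 b3] ord les by auto
  then consider
      "orb a1 b1" "short a2 b2" "short a3 b3"
    | "short a1 b1" "orb a2 b2" "short a3 b3"
    | "short a1 b1" "short a2 b2" "orb a3 b3"
    | "short a1 b1" "orb a2 b2" "orb a3 b3"
    | "orb a1 b1" "short a2 b2" "orb a3 b3"
    | "orb a1 b1" "orb a2 b2" "short a3 b3"
    using s none by blast
  then show ?thesis
  proof cases
    case 1
    have False
      by (rule addableD_first[OF turned[OF 1(1)] E[OF 1(2)] E[OF 1(3)]]) (use ord les in linarith)+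
    then show ?thesis ..
  next
    case 2
    have False
      by (rule addableD_middle[OF turned[OF 2(2)] E[OF 2(1)] E[OF 2(3)]]) (use ord les in linarith)+
    then show ?thesis ..
  next
    case 3
    have False
      by (rule addableD_last[OF turned[OF 3(3)] E[OF 3(1)] E[OF 3(2)]]) (use ord les in linarith)+
    then show ?thesis ..
  next
    case 4
    then have e: "a3 = a2 + n" "b3 = b2 + n" using two[of a2 b2 a3 b3] ord by simp_all
    \<comment> \<open>A chord crossing both turns from outside crosses one of them together with its
      own turn back. The last case is symmetric.\<close>
    have "E (a1 - n) (b1 - n)" using E[OF 4(1)] by (simp add: turn_back)
    then have False
      by (rule addableD_last[OF turned[OF 4(2)] _ E[OF 4(1)]]) (use ord les e in linarith)+
    then show ?thesis ..
  next
    case 5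
    then have e: "a3 = a1 + n" "b3 = b1 + n" using two[of a1 b1 a3 b3] ord by simp_all
    have "E (a2 - n) (b2 - n)" using E[OF 5(2)] by (simp add: turn_back)
    have "b2 \<le> a2 + n"
      by (rule ccontr, rule addableD_middle[OF turned[OF 5(1)] \<open>E (a2 - n) (b2 - n)\<close> E[OF 5(2)]])
        (use ord les e in linarith)+
    then have "obstruction a1 b1 a2 b2"
      using E[OF 5(2)] ord e by (simp add: obstruction_def)
    then show ?thesis using step[OF 5(1)] ord e by simp
  next
    case 6
    then have e: "a2 = a1 + n" "b2 = b1 + n" using two[of a1 b1 a2 b2] ord by simp_all
    have "E (a3 - n) (b3 - n)" using E[OF 6(3)] by (simp add: turn_back)
    then have False
      by (rule addableD_first[OF turned[OF 6(1)] _ E[OF 6(3)]]) (use ord les e in linarith)+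
    then show ?thesis ..
  qed
qed

text \<open>Maximality against adding whole orbits, which is \<open>maximal\<close>, is strengthened
  to maximality against adding single chords.\<close>

theorem addable_imp_edge:
  assumes free: "\<not> polygon_3_crossing (4 * n) E"
    and maximal: "\<And>a b. \<lbrakk>2 \<le> b - a; b - a \<le> 2 * n; \<not> E a b\<rbrakk> \<Longrightarrow>
       cover_3_crossing (\<lambda>x y. short x y \<or> (\<exists>k. x = a + k * n \<and> y = b + k * n))"
    and add: "addable a b" and len: "2 \<le> b - a" "b - a \<le> 2 * n"
  shows "E a b"
proof (rule ccontr)
  assume nE: "\<not> E a b"
  define Bad where "Bad g \<longleftrightarrow> addable (fst g) (snd g) \<and> 2 \<le> snd g - fst g \<and> snd g - fst g \<le> 2 * n
     \<and> \<not> E (fst g) (snd g)" for g :: "int \<times> int"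
  have "Bad (a, b)" using add len nE by (simp add: Bad_def)
  moreover have "\<forall>g. Bad g \<longrightarrow> nat (snd g - fst g) < nat (2 * n + 1)" using n_pos by (auto simp: Bad_def)
  ultimately obtain g where g: "Bad g" and gmax: "\<And>h. Bad h \<Longrightarrow> nat (snd h - fst h) \<le> nat (snd g - fst g)"
    using ex_has_greatest_nat[of Bad "(a, b)" "\<lambda>g. nat (snd g - fst g)" "nat (2 * n + 1)"]
    by (meson less_or_eq_imp_le)
  obtain u v where uv: "g = (u, v)" by force
  have G: "addable u v" "2 \<le> v - u" "v - u \<le> 2 * n" "\<not> E u v" using g by (auto simp: Bad_def uv)
  have longest: "E x y" if "addable x y" "y - x > v - u" "y - x \<le> 2 * n" for x y
  proof (rule ccontr)
    assume "\<not> E x y"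
    then have "Bad (x, y)" using that G by (simp add: Bad_def)
    from gmax[OF this] that G show False by (simp add: uv)
  qed
  have ob: "n < v - u \<and> (\<exists>c d. obstruction u v c d)"
    using G by (intro obstruction_exists free maximal) auto
  then obtain c0 d0 where "obstruction u v c0 d0" by blast
  moreover have "\<forall>f. (case f of (c, d) \<Rightarrow> obstruction u v c d) \<longrightarrow> nat (snd f - fst f) < nat (n + 1)"
    using n_pos by (auto simp: obstruction_def)
  ultimately obtain f where f: "case f of (c, d) \<Rightarrow> obstruction u v c d"
    and fmax: "\<And>h. (case h of (c, d) \<Rightarrow> obstruction u v c d) \<Longrightarrow> nat (snd h - fst h) \<le> nat (snd f - fst f)"
    using ex_has_greatest_nat[of "\<lambda>f. case f of (c, d) \<Rightarrow> obstruction u v c d" "(c0, d0)"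
       "\<lambda>g. nat (snd g - fst g)" "nat (n + 1)"]
    by (metis (no_types, lifting) less_or_eq_imp_le old.prod.case)
  obtain c d where cd: "f = (c, d)" by force
  have ob1: "obstruction u v c d" using f cd by simp
  have F: "E c d" "u < c" "c < u + n" "v < d" "d \<le> c + n"
    using ob1 by (auto simp: obstruction_def)
  have outer: "d' - c' \<le> d - c" if "obstruction u v c' d'" for c' d'
    using fmax[of "(c', d')"] that F G ob by (auto simp: cd)
  have "addable u d" "addable (c - n) v"
    using addable_extend[OF G(1) _ G(3) ob1 outer free] addable_extend_left[OF G(1) _ G(3) ob1 outer free] ob
    by blast+
  \<comment> \<open>Both chords are longer than \<open>{u, v}\<close> because \<open>v < d\<close>
    and \<open>c < u + n\<close>, and at most \<open>2 * n\<close> long because also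
    \<open>d \<le> c + n\<close>.\<close>
  then have e: "E u d" "E (c - n) v" using longest[of u d] longest[of "c - n" v] F G ob by linarith+
  then have "E (u + n) (d + n)" "E c (v + n)" using turn[of "c - n" v] by (simp_all add: turn)
  \<comment> \<open>The order is \<open>u < c < u + n < d < v + n < d + n\<close>; here
    \<open>d < v + n\<close> follows from \<open>d \<le> c + n < u + 2 * n < v + n\<close>.\<close>
  with e(1) have "polygon_3_crossing (4 * n) E"
    using polygon_3_crossingI[of E u d c "v + n" "u + n" "d + n"] F G ob by simp
  with free show False by blast
qed

end

section \<open>Crossing chords of the circle\<close>

text \<open>The left side is the signed distance of \<open>cis t\<close> from the line through
  \<open>cis a\<close> and \<open>cis b\<close>, turned to be vertical. The product makes its sign
  visible.\<close>

lemma chord_side_eq: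
  "Re (cis t * cis (- ((a + b) / 2))) - cos ((b - a) / 2) = 2 * sin ((t - a) / 2) * sin ((b - t) / 2)"
proof -
  have "Re (cis t * cis (- ((a + b) / 2))) = cos (t - (a + b) / 2)"
    by (simp add: cis_mult)
  moreover have "sin ((t - a) / 2) * sin ((b - t) / 2)
      = (cos ((t - a) / 2 - (b - t) / 2) - cos ((t - a) / 2 + (b - t) / 2)) / 2"
    by (rule sin_times_sin)
  moreover have "(t - a) / 2 - (b - t) / 2 = t - (a + b) / 2" "(t - a) / 2 + (b - t) / 2 = (b - a) / 2"
    by (simp_all add: field_simps)
  ultimately show ?thesis by simp
qed

text \<open>The affine function \<open>L\<close> vanishes on the first chord. On the second open
  chord it is positive, since one end point lies strictly inside the arc from \<open>a\<close> to
  \<open>b\<close>.\<close>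

lemma chords_disjoint:
  assumes "a \<le> c" "c < d" "d \<le> b" "b < a + 2 * pi" "(c, d) \<noteq> (a, b)"
  shows "open_segment (cis a) (cis b) \<inter> open_segment (cis c) (cis d) = {}"
proof -
  define w where "w = cis (- ((a + b) / 2))"
  define L where "L z = Re (z * w) - cos ((b - a) / 2)" for z
  have L: "L (cis t) = 2 * sin ((t - a) / 2) * sin ((b - t) / 2)" for t
    unfolding L_def w_def by (rule chord_side_eq)
  have affine: "L ((1 - t) *\<^sub>R x + t *\<^sub>R y) = (1 - t) * L x + t * L y" for t x y
    unfolding L_def by (simp add: algebra_simps)
  have nonneg: "L (cis t) \<ge> 0" if "a \<le> t" "t \<le> b" for t
    unfolding L using that assms by (intro mult_nonneg_nonneg sin_ge_zero) auto
  have pos: "L (cis t) > 0" if "a < t" "t < b" for t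
    unfolding L using that assms by (intro mult_pos_pos sin_gt_zero) auto
  have ends: "L (cis a) = 0" "L (cis b) = 0" unfolding L by simp_all
  have "L z > 0" if z: "z \<in> open_segment (cis c) (cis d)" for z
  proof -
    obtain t where t: "0 < t" "t < 1" "z = (1 - t) *\<^sub>R cis c + t *\<^sub>R cis d"
      using z by (auto simp: in_segment)
    have "L (cis c) \<ge> 0" "L (cis d) \<ge> 0" using nonneg assms by auto
    moreover have "L (cis c) > 0 \<or> L (cis d) > 0"
      using pos[of c] pos[of d] assms by fastforce
    ultimately show ?thesis unfolding t affine using t
      by (auto intro: add_pos_nonneg add_nonneg_pos)
  qed
  moreover have "L z = 0" if z: "z \<in> open_segment (cis a) (cis b)" for z
    using z ends by (auto simp: in_segment affine)
  ultimately show ?thesis by force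
qed

text \<open>A point of the line through two points of the unit circle lies between them as soon as it
  lies in the open disc.\<close>

lemma chords_cross:
  assumes "a < c" "c < b" "b < d" "d < a + 2 * pi"
  shows "open_segment (cis a) (cis b) \<inter> open_segment (cis c) (cis d) \<noteq> {}"
proof -
  define h where "h = (b - a) / 2"
  define w where "w = cis (- ((a + b) / 2))"
  define L where "L z = Re (z * w) - cos h" for z
  have L: "L (cis t) = 2 * sin ((t - a) / 2) * sin ((b - t) / 2)" for t
    unfolding L_def w_def h_def by (rule chord_side_eq)
  have "L (cis c) > 0"
    unfolding L using assms by (intro mult_pos_pos sin_gt_zero) auto
  moreover have "sin ((d - b) / 2) > 0"
    using assms by (intro sin_gt_zero) auto
  then have "sin ((b - d) / 2) < 0"
    by (metis minus_diff_eq minus_divide_left neg_less_0_iff_less sin_minus)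
  then have "L (cis d) < 0"
    unfolding L using assms by (intro mult_pos_neg) (auto intro!: sin_gt_zero)
  ultimately obtain t where t: "0 < t" "t < 1" "(1 - t) * L (cis c) + t * L (cis d) = 0"
  proof -
    assume *: "L (cis c) > 0" "L (cis d) < 0"
      and th: "\<And>t. \<lbrakk>0 < t; t < 1; (1 - t) * L (cis c) + t * L (cis d) = 0\<rbrakk> \<Longrightarrow> thesis"
    show thesis
      by (rule th[of "L (cis c) / (L (cis c) - L (cis d))"]) (use * in \<open>auto simp: field_simps\<close>)
  qed
  define z where "z = (1 - t) *\<^sub>R cis c + t *\<^sub>R cis d"
  have ne: "cis c \<noteq> cis d"
    using \<open>L (cis c) > 0\<close> \<open>L (cis d) < 0\<close> by auto
  then have z: "z \<in> open_segment (cis c) (cis d)"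
    using t by (auto simp: in_segment z_def)
  have "L z = 0"
    using t(3) unfolding z_def L_def by (simp add: algebra_simps)
  define y where "y = Im (z * w)"
  have zw: "z * w = Complex (cos h) y"
    using \<open>L z = 0\<close> by (simp add: complex_eq_iff L_def y_def)
  \<comment> \<open>An interior point of a chord is closer to the centre than one of its end
    points.\<close>
  have "norm z < 1"
    using dist_decreases_open_segment[OF z, of 0] by auto
  then have "norm (z * w) < 1" by (simp add: norm_mult w_def)
  then have "(cos h)\<^sup>2 + y\<^sup>2 < 1" by (simp add: zw cmod_def)
  then have "y\<^sup>2 < (sin h)\<^sup>2" using sin_cos_squared_add[of h] by linarith
  moreover have sh: "sin h > 0" using assms by (intro sin_gt_zero) (auto simp: h_def)
  ultimately have y: "- sin h < y" "y < sin h"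
    using power2_less_imp_less[of "\<bar>y\<bar>" "sin h"] by auto
  \<comment> \<open>After the rotation by \<open>w\<close> the chord is vertical, with heights from
    \<open>- sin h\<close> to \<open>sin h\<close>; \<open>s\<close> is the relative position of
    height \<open>y\<close>.\<close>
  define s where "s = (y + sin h) / (2 * sin h)"
  have s: "0 < s" "s < 1" using y sh by (auto simp: s_def field_simps)
  have s2: "2 * s * sin h = y + sin h" using sh by (simp add: s_def)
  have "a - (a + b) / 2 = - h" "b - (a + b) / 2 = h"
    by (simp_all add: h_def field_simps)
  then have "cis a * w = cis (- h)" "cis b * w = cis h"
    by (simp_all add: w_def cis_mult)
  then have "((1 - s) *\<^sub>R cis a + s *\<^sub>R cis b) * w = (1 - s) *\<^sub>R cis (- h) + s *\<^sub>R cis h"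
    by (simp add: algebra_simps)
  also have "\<dots> = z * w"
    unfolding zw using s2 by (simp add: complex_eq_iff algebra_simps)
  finally have "(1 - s) *\<^sub>R cis a + s *\<^sub>R cis b = z" by (simp add: w_def)
  moreover have "cis a \<noteq> cis b"
    using \<open>cis a * w = cis (- h)\<close> \<open>cis b * w = cis h\<close> sh by (auto simp: complex_eq_iff)
  ultimately have "z \<in> open_segment (cis a) (cis b)"
    using s by (auto simp: in_segment)
  with z show ?thesis by blast
qed

section \<open>Polygon vertices and diagonals through integer indices\<close>

lemma vertex_eq_iff:
  assumes "m > 0"
  shows "vertex m i = vertex m j \<longleftrightarrow> int m dvd i - j"
proof -
  have "vertex m i = vertex m j \<longleftrightarrow> (\<exists>k. 2 * pi * real_of_int i / real m = 2 * pi * real_of_int j / real m + 2 * pi * of_int k)"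
    unfolding vertex_def by (simp add: complex_eq_iff conj_commute flip: sin_cos_eq_iff)
  also have "\<dots> \<longleftrightarrow> (\<exists>k. i - j = int m * k)"
  proof (intro ex_cong1)
    fix k
    have "2 * pi * real_of_int i / real m = 2 * pi * real_of_int j / real m + 2 * pi * of_int k
       \<longleftrightarrow> 2 * pi * real_of_int i = 2 * pi * (real_of_int j + real m * of_int k)"
      using assms by (simp add: field_simps)
    also have "\<dots> \<longleftrightarrow> real_of_int i = real_of_int (j + int m * k)" by simp
    also have "\<dots> \<longleftrightarrow> i - j = int m * k" unfolding of_int_eq_iff by linarith
    finally show "2 * pi * real_of_int i / real m = 2 * pi * real_of_int j / real m + 2 * pi * of_int k
       \<longleftrightarrow> i - j = int m * k" .
  qed
  finally show ?thesis by (simp add: dvd_def)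
qed

text \<open>The free choice of \<open>p\<close> allows indexing to start at an end point of another
  chord.\<close>

lemma chord_pair_window:
  fixes p :: int
  assumes "m > 0" "u \<in> range (vertex m)" "w \<in> range (vertex m)" "u \<noteq> w"
  shows "\<exists>r s. p \<le> r \<and> r < s \<and> s < p + int m \<and> {u, w} = {vertex m r, vertex m s}"
proof -
  have "\<exists>r. p \<le> r \<and> r < p + int m \<and> x = vertex m r" if "x \<in> range (vertex m)" for x
  proof -
    from that obtain i where i: "x = vertex m i" by blast
    have "x = vertex m (p + (i - p) mod int m)"
      unfolding i vertex_eq_iff[OF assms(1)] by (metis diff_diff_eq dvd_minus_mod)
    moreover have "0 \<le> (i - p) mod int m" "(i - p) mod int m < int m" using assms(1) by auto
    ultimately show ?thesis by (intro exI[of _ "p + (i - p) mod int m"]) auto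
  qed
  then obtain r s where r: "p \<le> r" "r < p + int m" "u = vertex m r"
    and s: "p \<le> s" "s < p + int m" "w = vertex m s" using assms by meson
  then have "r \<noteq> s" using assms by auto
  then show ?thesis using r s
    by (cases "r < s") (metis, metis insert_commute linorder_neqE)
qed

lemma vertex_angle_mono:
  assumes "m > 0"
  shows "2 * pi * real_of_int i / real m < 2 * pi * real_of_int j / real m \<longleftrightarrow> i < j"
    and "2 * pi * real_of_int i / real m \<le> 2 * pi * real_of_int j / real m \<longleftrightarrow> i \<le> j"
    and "2 * pi * real_of_int i / real m < 2 * pi * real_of_int j / real m + 2 * pi \<longleftrightarrow> i < j + int m"
proof -
  show "2 * pi * real_of_int i / real m < 2 * pi * real_of_int j / real m \<longleftrightarrow> i < j"
    "2 * pi * real_of_int i / real m \<le> 2 * pi * real_of_int j / real m \<longleftrightarrow> i \<le> j"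
    using assms by (simp_all add: divide_less_cancel divide_le_cancel)
  have "2 * pi * real_of_int j / real m + 2 * pi = 2 * pi * real_of_int (j + int m) / real m"
    using assms by (simp add: field_simps)
  then show "2 * pi * real_of_int i / real m < 2 * pi * real_of_int j / real m + 2 * pi \<longleftrightarrow> i < j + int m"
    using assms by (simp add: divide_less_cancel del: of_int_add)
qed

lemma diagonals_intersect_iff_segments:
  "diagonals_intersect {u, v} {w, x} \<longleftrightarrow> open_segment u v \<inter> open_segment w x \<noteq> {}"
  unfolding diagonals_intersect_def doubleton_eq_iff by (metis open_segment_commute)

lemma diagonals_intersect_sym: "diagonals_intersect d e \<Longrightarrow> diagonals_intersect e d"
  unfolding diagonals_intersect_def by blast

text \<open>Since the indices start at \<open>p\<close>, only one of the two linear crossing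
  patterns can occur. The assumption \<open>ne\<close> excludes a diagonal meeting itself.\<close>

lemma diagonals_intersect_iff:
  assumes m: "m > 0" and ord: "p < q" "p \<le> r" "r < s" "s < p + int m" "q < p + int m"
    and ne: "{vertex m p, vertex m q} \<noteq> {vertex m r, vertex m s}"
  shows "diagonals_intersect {vertex m p, vertex m q} {vertex m r, vertex m s} \<longleftrightarrow> p < r \<and> r < q \<and> q < s"
proof
  assume "p < r \<and> r < q \<and> q < s"
  then show "diagonals_intersect {vertex m p, vertex m q} {vertex m r, vertex m s}"
    unfolding diagonals_intersect_iff_segments vertex_def
    using ord m by (intro chords_cross) (simp_all add: vertex_angle_mono)
next
  define ang where "ang i = 2 * pi * real_of_int i / real m" for i
  have v: "vertex m i = cis (ang i)" for i by (simp add: vertex_def ang_def)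
  note mono = vertex_angle_mono[OF m, folded ang_def]
  have disj: "open_segment (vertex m i) (vertex m j) \<inter> open_segment (vertex m k) (vertex m l) = {}"
    if "i \<le> k" "k < l" "l \<le> j" "j < i + int m" "(k, l) \<noteq> (i, j)" for i j k l
  proof -
    have "(ang k, ang l) \<noteq> (ang i, ang j)"
      using that mono(1)[of i k] mono(1)[of l j] by auto
    then show ?thesis
      unfolding v using that by (intro chords_disjoint) (simp_all add: mono)
  qed
  have pm: "vertex m (p + int m) = vertex m p" by (simp add: vertex_eq_iff[OF m])
  assume *: "diagonals_intersect {vertex m p, vertex m q} {vertex m r, vertex m s}"
  show "p < r \<and> r < q \<and> q < s"
  proof (rule ccontr)
    assume "\<not> ?thesis"
    moreover have "(r, s) \<noteq> (p, q)" using ne by auto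
    \<comment> \<open>The second chord lies over the arc of the first, or the first over the arc of
      the second, or the second over the complementary arc from \<open>q\<close> to
      \<open>p + int m\<close>.\<close>
    ultimately consider "s \<le> q" "(r, s) \<noteq> (p, q)" | "r = p" "q < s" | "q \<le> r" using ord by force
    then have "open_segment (vertex m p) (vertex m q) \<inter> open_segment (vertex m r) (vertex m s) = {}"
    proof cases
      case 1
      then show ?thesis using disj[of p r s q] ord by simp
    next
      case 2
      then show ?thesis using disj[of r p q s] ord by (simp add: Int_commute)
    next
      case 3
      then show ?thesis using disj[of q r s "p + int m"] ord
        by (simp add: pm open_segment_commute)
    qed
    with * show False unfolding diagonals_intersect_iff_segments by blast
  qed
qed

lemma doubleton_vertex_window:
  assumes "m > 0" "p \<le> x" "x < y" "y < p + int m" "p \<le> x'" "x' < y'" "y' < p + int m"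
    "{vertex m x, vertex m y} = {vertex m x', vertex m y'}"
  shows "x = x' \<and> y = y'"
proof -
  have inj: "i = j" if "vertex m i = vertex m j" "p \<le> i" "p \<le> j" "i < p + int m" "j < p + int m" for i j
    using that zdvd_imp_le[of "int m" "i - j"] zdvd_imp_le[of "int m" "j - i"]
    by (cases i j rule: linorder_cases) (auto simp: vertex_eq_iff[OF assms(1)] dvd_diff_commute)
  have "x = x' \<and> y = y' \<or> x = y' \<and> y = x'"
    using assms(8) inj[of x x'] inj[of y y'] inj[of x y'] inj[of y x'] assms(2-7)
    unfolding doubleton_eq_iff by auto
  then show ?thesis using assms by linarith
qed

section \<open>3-crossings of edge sets in terms of indices\<close>

lemma card_3_pairwise_iff:
  assumes "\<And>x y. R x y \<Longrightarrow> R y x"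
  shows "(\<exists>S \<subseteq> E. card S = 3 \<and> pairwise R S) \<longleftrightarrow>
    (\<exists>d e f. d \<in> E \<and> e \<in> E \<and> f \<in> E \<and> d \<noteq> e \<and> e \<noteq> f \<and> d \<noteq> f \<and> R d e \<and> R e f \<and> R d f)"
proof
  assume "\<exists>S \<subseteq> E. card S = 3 \<and> pairwise R S"
  then obtain d e f where "{d, e, f} \<subseteq> E" "pairwise R {d, e, f}" "d \<noteq> e" "e \<noteq> f" "d \<noteq> f"
    unfolding card_3_iff by metis
  then show "\<exists>d e f. d \<in> E \<and> e \<in> E \<and> f \<in> E \<and> d \<noteq> e \<and> e \<noteq> f \<and> d \<noteq> f \<and> R d e \<and> R e f \<and> R d f"
    by (intro exI[of _ d] exI[of _ e] exI[of _ f]) (simp add: pairwise_insert)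
next
  assume "\<exists>d e f. d \<in> E \<and> e \<in> E \<and> f \<in> E \<and> d \<noteq> e \<and> e \<noteq> f \<and> d \<noteq> f \<and> R d e \<and> R e f \<and> R d f"
  then obtain d e f where def: "d \<in> E" "e \<in> E" "f \<in> E" "d \<noteq> e" "e \<noteq> f" "d \<noteq> f" "R d e" "R e f" "R d f"
    by blast
  then have "{d, e, f} \<subseteq> E" "card {d, e, f} = 3" "pairwise R {d, e, f}"
    using assms by (auto simp: pairwise_insert)
  then show "\<exists>S \<subseteq> E. card S = 3 \<and> pairwise R S" by blast
qed

text \<open>Indexing starts at an end point of the first diagonal, so the other two start after it
  and only their mutual order remains open.\<close>

lemma no_3_crossing_polygon_iff:
  assumes m: "m > 0" and D: "D \<subseteq> polygon_diagonals m"
  shows "no_3_crossing diagonals_intersect D \<longleftrightarrow>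
    \<not> polygon_3_crossing (int m) (\<lambda>x y. {vertex m x, vertex m y} \<in> D)"
proof -
  let ?v = "vertex m"
  have "(\<exists>d e f. d \<in> D \<and> e \<in> D \<and> f \<in> D \<and> d \<noteq> e \<and> e \<noteq> f \<and> d \<noteq> f \<and> diagonals_intersect d e
      \<and> diagonals_intersect e f \<and> diagonals_intersect d f) \<longleftrightarrow>
     polygon_3_crossing (int m) (\<lambda>x y. {?v x, ?v y} \<in> D)" (is "?L \<longleftrightarrow> ?R")
  proof
    assume ?L
    then obtain d e f where def: "d \<in> D" "e \<in> D" "f \<in> D" "d \<noteq> e" "e \<noteq> f" "d \<noteq> f"
      "diagonals_intersect d e" "diagonals_intersect e f" "diagonals_intersect d f" by blast
    have window: "\<exists>r s. p \<le> r \<and> r < s \<and> s < p + int m \<and> x = {?v r, ?v s}" if "x \<in> D" for x p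
    proof -
      from that D obtain u w where "x = {u, w}" "u \<in> range ?v" "w \<in> range ?v" "u \<noteq> w"
        unfolding polygon_diagonals_def by blast
      then show ?thesis using chord_pair_window[OF m] by blast
    qed
    obtain p q where d: "p < q" "q < p + int m" "d = {?v p, ?v q}" using window[OF def(1)] by force
    obtain r s where e: "p \<le> r" "r < s" "s < p + int m" "e = {?v r, ?v s}" using window[OF def(2)] by force
    obtain x y where f: "p \<le> x" "x < y" "y < p + int m" "f = {?v x, ?v y}" using window[OF def(3)] by force
    have de: "p < r" "r < q" "q < s"
      using diagonals_intersect_iff[OF m d(1) e(1-3) d(2)] def d e by auto
    have df: "p < x" "x < q" "q < y"
      using diagonals_intersect_iff[OF m d(1) f(1-3) d(2)] def d f by auto
    show ?R
    proof (cases "r \<le> x")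
      case True
      then have "r < x" "s < y"
        using diagonals_intersect_iff[OF m e(2) True f(2)] def e f df by auto
      then show ?thesis using polygon_3_crossingI[of "\<lambda>x y. {?v x, ?v y} \<in> D" p q r s x y] def d e f de df
        by simp
    next
      case False
      then have "x \<le> r" by simp
      then have "x < r" "y < s"
        using diagonals_intersect_iff[OF m f(2) _ e(2)] def(8)[THEN diagonals_intersect_sym] def e f df de by auto
      then show ?thesis using polygon_3_crossingI[of "\<lambda>x y. {?v x, ?v y} \<in> D" p q x y r s] def d e f de df
        by simp
    qed
  next
    assume ?R
    then obtain p1 p2 p3 p4 p5 p6 where o: "p1 < p2" "p2 < p3" "p3 < p4" "p4 < p5" "p5 < p6" "p6 < p1 + int m"
      and D: "{?v p1, ?v p4} \<in> D" "{?v p2, ?v p5} \<in> D" "{?v p3, ?v p6} \<in> D"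
      unfolding polygon_3_crossing_def by blast
    have "{?v p1, ?v p4} \<noteq> {?v p2, ?v p5}" "{?v p1, ?v p4} \<noteq> {?v p3, ?v p6}" "{?v p2, ?v p5} \<noteq> {?v p3, ?v p6}"
      using doubleton_vertex_window[OF m, of p1 p1 p4 p2 p5] doubleton_vertex_window[OF m, of p1 p1 p4 p3 p6]
        doubleton_vertex_window[OF m, of p1 p2 p5 p3 p6] o by auto
    then show ?L
      using D o diagonals_intersect_iff[OF m, of p1 p4 p2 p5] diagonals_intersect_iff[OF m, of p1 p4 p3 p6]
        diagonals_intersect_iff[OF m, of p2 p5 p3 p6]
      by (intro exI[of _ "{?v p1, ?v p4}"] exI[of _ "{?v p2, ?v p5}"] exI[of _ "{?v p3, ?v p6}"]) simp
  qed
  moreover have "(\<exists>S \<subseteq> D. card S = 3 \<and> pairwise diagonals_intersect S) \<longleftrightarrow> ?L"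
    by (rule card_3_pairwise_iff) (rule diagonals_intersect_sym)
  ultimately show ?thesis
    unfolding no_3_crossing_def by (simp only:)
qed

lemma cover_intersect_iff:
  assumes "a < b" "c < d"
  shows "cover_intersect {a, b} {c, d} \<longleftrightarrow> (a < c \<and> c < b \<and> b < d) \<or> (c < a \<and> a < d \<and> d < b)"
  (is "_ \<longleftrightarrow> ?R")
proof
  assume "cover_intersect {a, b} {c, d}"
  then obtain a1 a2 b1 b2 where "a1 < a2" "a2 < b1" "b1 < b2"
    "{{a, b}, {c, d}} = {{a1, b1}, {a2, b2}}" unfolding cover_intersect_def by blast
  then show ?R using assms by (auto simp: doubleton_eq_iff)
next
  assume ?R
  then show "cover_intersect {a, b} {c, d}"
    unfolding cover_intersect_def by (blast intro: insert_commute)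
qed

lemma cover_edge_ordered:
  assumes "e \<in> cover_edges"
  shows "\<exists>x y. x < y \<and> e = {x, y}"
proof -
  from assms obtain i j where "e = {i, j}" "i \<noteq> j" unfolding cover_edges_def by blast
  then show ?thesis by (metis insert_commute linorder_neqE)
qed

text \<open>Sorting pairwise crossing edges by left end points also sorts the right ones; the six
  cases are the possible orders.\<close>

lemma no_3_crossing_cover_iff:
  assumes P: "P \<subseteq> cover_edges"
  shows "no_3_crossing cover_intersect P \<longleftrightarrow> \<not> cover_3_crossing (\<lambda>x y. {x, y} \<in> P)"
proof -
  have s: "cover_intersect d e \<Longrightarrow> cover_intersect e d" for d e
    unfolding cover_intersect_def by (metis insert_commute)
  have "(\<exists>d e f. d \<in> P \<and> e \<in> P \<and> f \<in> P \<and> d \<noteq> e \<and> e \<noteq> f \<and> d \<noteq> f \<and> cover_intersect d e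
      \<and> cover_intersect e f \<and> cover_intersect d f) \<longleftrightarrow> cover_3_crossing (\<lambda>x y. {x, y} \<in> P)" (is "?L \<longleftrightarrow> ?R")
  proof
    assume ?L
    then obtain d e f where def: "d \<in> P" "e \<in> P" "f \<in> P"
      "cover_intersect d e" "cover_intersect e f" "cover_intersect d f" by blast
    obtain a b where d: "a < b" "d = {a, b}" using cover_edge_ordered P def by blast
    obtain a' b' where e: "a' < b'" "e = {a', b'}" using cover_edge_ordered P def by blast
    obtain a'' b'' where f: "a'' < b''" "f = {a'', b''}" using cover_edge_ordered P def by blast
    note I = cover_3_crossingI[of "\<lambda>x y. {x, y} \<in> P"]
    have c: "a < a' \<and> a' < b \<and> b < b' \<or> a' < a \<and> a < b' \<and> b' < b"
         "a' < a'' \<and> a'' < b' \<and> b' < b'' \<or> a'' < a' \<and> a' < b'' \<and> b'' < b'"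
         "a < a'' \<and> a'' < b \<and> b < b'' \<or> a'' < a \<and> a < b'' \<and> b'' < b"
      using def(4-6) unfolding d e f cover_intersect_iff[OF d(1) e(1)] cover_intersect_iff[OF e(1) f(1)]
        cover_intersect_iff[OF d(1) f(1)] by simp_all
    have mem: "{a, b} \<in> P" "{a', b'} \<in> P" "{a'', b''} \<in> P" using def d e f by auto
    consider "a < a'" "a' < a''" | "a < a''" "a'' < a'" | "a' < a" "a < a''" | "a' < a''" "a'' < a"
      | "a'' < a" "a < a'" | "a'' < a'" "a' < a" using c by linarith
    then show ?R
    proof cases
      case 1 show ?thesis by (rule I[OF mem(1) mem(2) mem(3)]) (use 1 c in linarith)+
    next
      case 2 show ?thesis by (rule I[OF mem(1) mem(3) mem(2)]) (use 2 c in linarith)+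
    next
      case 3 show ?thesis by (rule I[OF mem(2) mem(1) mem(3)]) (use 3 c in linarith)+
    next
      case 4 show ?thesis by (rule I[OF mem(2) mem(3) mem(1)]) (use 4 c in linarith)+
    next
      case 5 show ?thesis by (rule I[OF mem(3) mem(1) mem(2)]) (use 5 c in linarith)+
    next
      case 6 show ?thesis by (rule I[OF mem(3) mem(2) mem(1)]) (use 6 c in linarith)+
    qed
  next
    assume ?R
    then obtain a1 a2 a3 b1 b2 b3 where o: "a1 < a2" "a2 < a3" "a3 < b1" "b1 < b2" "b2 < b3"
      and "{a1, b1} \<in> P" "{a2, b2} \<in> P" "{a3, b3} \<in> P" unfolding cover_3_crossing_def by blast
    moreover have "{a1, b1} \<noteq> {a2, b2}" "{a1, b1} \<noteq> {a3, b3}" "{a2, b2} \<noteq> {a3, b3}"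
      using o by (auto simp: doubleton_eq_iff)
    moreover have "cover_intersect {a1, b1} {a2, b2}" "cover_intersect {a1, b1} {a3, b3}"
        "cover_intersect {a2, b2} {a3, b3}"
      using o by (simp_all add: cover_intersect_iff)
    ultimately show ?L by blast
  qed
  moreover have "(\<exists>S \<subseteq> P. card S = 3 \<and> pairwise cover_intersect S) \<longleftrightarrow> ?L"
    by (rule card_3_pairwise_iff) (rule s)
  ultimately show ?thesis
    unfolding no_3_crossing_def by (simp only:)
qed

section \<open>The canonical map\<close>

lemma translate_pair: "translate n l {x, y} = {x + l * int n, y + l * int n}"
  by (simp add: translate_def)

lemma translate_translate: "translate n k (translate n l e) = translate n (k + l) e"
  by (simp add: translate_def image_image algebra_simps)

lemma translate_0 [simp]: "translate n 0 e = e"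
  by (simp add: translate_def)

lemma proj_edge_eq_iff: "proj_edge n e = proj_edge n f \<longleftrightarrow> (\<exists>l. f = translate n l e)"
proof
  assume "proj_edge n e = proj_edge n f"
  moreover have "f \<in> proj_edge n f" unfolding proj_edge_def by (auto intro: exI[of _ 0])
  ultimately show "\<exists>l. f = translate n l e" unfolding proj_edge_def by blast
next
  assume "\<exists>l. f = translate n l e"
  then obtain l where l: "f = translate n l e" by blast
  then have e: "e = translate n (- l) f" by (simp add: translate_translate)
  show "proj_edge n e = proj_edge n f"
  proof
    show "proj_edge n e \<subseteq> proj_edge n f"
      unfolding proj_edge_def by (subst e) (auto simp: translate_translate)
    show "proj_edge n f \<subseteq> proj_edge n e"
      unfolding proj_edge_def by (subst l) (auto simp: translate_translate)
  qed
qed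

lemma proj_edge_shift: "proj_edge n {x + l * int n, y + l * int n} = proj_edge n {x, y}"
  by (metis proj_edge_eq_iff translate_pair)

lemma proj_edge_pair_eqD:
  assumes "proj_edge n {x, y} = proj_edge n {x', y'}" "x < y" "x' < y'"
  shows "\<exists>l. x' = x + l * int n \<and> y' = y + l * int n"
  using assms unfolding proj_edge_eq_iff translate_pair doubleton_eq_iff by force

lemma edge_length_pair: "x < y \<Longrightarrow> edge_length {x, y} = y - x"
  by (simp add: edge_length_def)

lemma pair_in_cover_edges: "x < y \<Longrightarrow> {x, y} \<in> cover_edges"
  unfolding cover_edges_def by force

text \<open>The bound is half the number of polygon vertices and, for \<open>n \<ge> 1\<close>, also
  the largest length at which the translations of one edge contain no 3-crossing.\<close>

definition short_cyl_edges :: "nat \<Rightarrow> int set set set" where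
  "short_cyl_edges n = {proj_edge n {x, y} | x y. 2 \<le> y - x \<and> y - x \<le> 2 * int n}"

lemma cyl_edges_eq: "cyl_edges n = {proj_edge n {x, y} | x y. 2 \<le> y - x}"
proof (intro set_eqI iffI)
  fix c assume "c \<in> cyl_edges n"
  then obtain e where e: "e \<in> cover_edges" "2 \<le> edge_length e" "c = proj_edge n e"
    unfolding cyl_edges_def by blast
  from cover_edge_ordered[OF e(1)] obtain x y where "x < y" "e = {x, y}" by blast
  with e show "c \<in> {proj_edge n {x, y} | x y. 2 \<le> y - x}" by (auto simp: edge_length_pair)
next
  fix c assume "c \<in> {proj_edge n {x, y} | x y. 2 \<le> y - x}"
  then obtain x y where "c = proj_edge n {x, y}" "2 \<le> y - x" by blast
  then show "c \<in> cyl_edges n"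
    unfolding cyl_edges_def by (auto simp: edge_length_pair pair_in_cover_edges intro!: imageI)
qed

lemma short_cyl_edges_subset: "short_cyl_edges n \<subseteq> cyl_edges n"
  unfolding short_cyl_edges_def cyl_edges_eq by blast

lemma preimage_edges_subset: "preimage_edges n T \<subseteq> cover_edges"
  by (auto simp: preimage_edges_def)

lemma pair_in_preimage: "x < y \<Longrightarrow> {x, y} \<in> preimage_edges n T \<longleftrightarrow> proj_edge n {x, y} \<in> T"
  by (simp add: preimage_edges_def pair_in_cover_edges)

lemma short_cyl_edgesD:
  assumes "proj_edge n {x, y} \<in> short_cyl_edges n" "x < y"
  shows "2 \<le> y - x" "y - x \<le> 2 * int n"
proof -
  from assms(1) obtain x' y' where *: "proj_edge n {x, y} = proj_edge n {x', y'}"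
     "2 \<le> y' - x'" "y' - x' \<le> 2 * int n" unfolding short_cyl_edges_def by blast
  from proj_edge_pair_eqD[OF *(1)] assms * have "y' - x' = y - x" by auto
  with * show "2 \<le> y - x" "y - x \<le> 2 * int n" by auto
qed

text \<open>An edge longer than \<open>2n\<close> forms a 3-crossing with two of its own translations.\<close>

lemma no_3_crossing_imp_short:
  assumes T: "T \<subseteq> cyl_edges n" and n: "n \<ge> 1"
    and free: "no_3_crossing cover_intersect (preimage_edges n T)"
  shows "T \<subseteq> short_cyl_edges n"
proof
  fix c assume c: "c \<in> T"
  with T obtain x y where xy: "c = proj_edge n {x, y}" "2 \<le> y - x" unfolding cyl_edges_eq by blast
  have "y - x \<le> 2 * int n"
  proof (rule ccontr)
    assume long: "\<not> ?thesis"
    have mem: "{x + l * int n, y + l * int n} \<in> preimage_edges n T" for l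
      using c xy by (subst pair_in_preimage) (auto simp: proj_edge_shift)
    have "cover_3_crossing (\<lambda>x y. {x, y} \<in> preimage_edges n T)"
      by (rule cover_3_crossingI[of "\<lambda>x y. {x, y} \<in> preimage_edges n T", OF mem[of 0] mem[of 1] mem[of 2]]) (use long n in auto)
    with free show False by (simp add: no_3_crossing_cover_iff preimage_edges_subset)
  qed
  with xy show "c \<in> short_cyl_edges n" unfolding short_cyl_edges_def by blast
qed

section \<open>Wrapping short edges around the polygon\<close>

lemma vertex_image_eqD:
  assumes n: "n \<ge> 1" and len: "0 < y - x" "y - x \<le> 2 * int n" "0 < y' - x'" "y' - x' \<le> 2 * int n"
    and eq: "{vertex (4 * n) x, vertex (4 * n) y} = {vertex (4 * n) x', vertex (4 * n) y'}"
  shows "proj_edge n {x, y} = proj_edge n {x', y'}"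
proof -
  have pos: "4 * n > 0" and N: "int (4 * n) = 4 * int n" and n0: "int n > 0" using n by auto
  have unique: "i = j" if "i * (4 * int n) < j * (4 * int n) + 4 * int n" "j * (4 * int n) < i * (4 * int n) + 4 * int n" for i j
  proof -
    have "i * (4 * int n) < (j + 1) * (4 * int n)" "j * (4 * int n) < (i + 1) * (4 * int n)"
      using that by (simp_all add: distrib_right)
    then show ?thesis using n0 by (simp add: mult_less_cancel_right)
  qed
  consider "4 * int n dvd x' - x" "4 * int n dvd y' - y" | "4 * int n dvd x' - y" "4 * int n dvd y' - x"
    using eq unfolding doubleton_eq_iff vertex_eq_iff[OF pos] N by (metis dvd_diff_commute)
  then show ?thesis
  proof cases
    case 1
    then obtain i j where ij: "x' - x = i * (4 * int n)" "y' - y = j * (4 * int n)"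
      by (auto simp: dvd_def mult.commute)
    have "i = j" by (rule unique) (use ij len in linarith)+
    then have "x' = x + (4 * i) * int n" "y' = y + (4 * i) * int n" using ij by (simp_all add: algebra_simps)
    then show ?thesis by (simp only: proj_edge_shift)
  next
    case 2
    then obtain i j where ij: "x' - y = i * (4 * int n)" "y' - x = j * (4 * int n)"
      by (auto simp: dvd_def mult.commute)
    have "j = i + 1" by (rule unique; unfold distrib_right) (use ij len n0 in linarith)+
    \<comment> \<open>Swapped end points mean complementary arcs. Both have length at most
      \<open>2 * int n\<close>, so the chord is a diameter, and its two lifts differ by a half turn,
      which is a translation.\<close>
    then have "y' - x' = 4 * int n - (y - x)" using ij by (simp add: algebra_simps)
    then have "y = x + 2 * int n" using len by linarith
    then have "x' = x + (4 * i + 2) * int n" "y' = y + (4 * i + 2) * int n"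
      using ij \<open>j = i + 1\<close> by (simp_all add: algebra_simps)
    then show ?thesis by (simp only: proj_edge_shift)
  qed
qed

lemma canonical_mapI:
  assumes "proj_edge n {x, y} \<in> T" "x < y"
  shows "{vertex (4 * n) x, vertex (4 * n) y} \<in> canonical_map n T"
  unfolding canonical_map_def using assms
  by (intro image_eqI[of _ _ "{x, y}"]) (simp_all add: pair_in_preimage)

lemma canonical_mapE:
  assumes "d \<in> canonical_map n T"
  obtains x y where "x < y" "proj_edge n {x, y} \<in> T" "d = {vertex (4 * n) x, vertex (4 * n) y}"
proof -
  from assms obtain e where e: "e \<in> preimage_edges n T" "d = vertex (4 * n) ` e"
    unfolding canonical_map_def by blast
  from e obtain x y where "x < y" "e = {x, y}"
    using cover_edge_ordered preimage_edges_subset by blast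
  with e that show thesis by (simp add: pair_in_preimage)
qed

lemma canonical_map_iff:
  assumes n: "n \<ge> 1" and T: "T \<subseteq> short_cyl_edges n" and xy: "x < y" "y - x \<le> 2 * int n"
  shows "{vertex (4 * n) x, vertex (4 * n) y} \<in> canonical_map n T \<longleftrightarrow> proj_edge n {x, y} \<in> T"
proof
  assume "{vertex (4 * n) x, vertex (4 * n) y} \<in> canonical_map n T"
  then obtain x' y' where *: "x' < y'" "proj_edge n {x', y'} \<in> T"
    "{vertex (4 * n) x, vertex (4 * n) y} = {vertex (4 * n) x', vertex (4 * n) y'}"
    by (rule canonical_mapE)
  then have "y' - x' \<le> 2 * int n" using short_cyl_edgesD(2)[of n x' y'] T by auto
  then have "proj_edge n {x, y} = proj_edge n {x', y'}"
    using vertex_image_eqD[OF n _ xy(2) _ _ *(3)] *(1) xy by simp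
  with * show "proj_edge n {x, y} \<in> T" by simp
qed (use canonical_mapI xy in blast)

text \<open>The form with inclusions serves both injectivity and the transfer of maximality.\<close>

lemma canonical_map_subset_iff:
  assumes n: "n \<ge> 1" and T: "T \<subseteq> short_cyl_edges n" and U: "U \<subseteq> short_cyl_edges n"
  shows "canonical_map n T \<subseteq> canonical_map n U \<longleftrightarrow> T \<subseteq> U"
proof
  assume *: "canonical_map n T \<subseteq> canonical_map n U"
  show "T \<subseteq> U"
  proof
    fix c assume c: "c \<in> T"
    with T obtain x y where xy: "c = proj_edge n {x, y}" "2 \<le> y - x" "y - x \<le> 2 * int n"
      unfolding short_cyl_edges_def by blast
    with c * have "{vertex (4 * n) x, vertex (4 * n) y} \<in> canonical_map n U"
      using canonical_mapI[of n x y T] by auto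
    then show "c \<in> U" using canonical_map_iff[OF n U, of x y] xy by simp
  qed
next
  assume "T \<subseteq> U"
  then show "canonical_map n T \<subseteq> canonical_map n U"
    unfolding canonical_map_def preimage_edges_def by blast
qed

lemma quarter_turn_vertex:
  assumes "n \<ge> 1"
  shows "cis (pi / 2) * vertex (4 * n) i = vertex (4 * n) (i + int n)"
proof -
  have "pi / 2 + 2 * pi * real_of_int i / real (4 * n) = 2 * pi * real_of_int (i + int n) / real (4 * n)"
    using assms by (simp add: field_simps)
  then show ?thesis unfolding vertex_def cis_mult by simp
qed

lemma quarter_turn_invariantD:
  assumes n: "n \<ge> 1" and inv: "quarter_turn_invariant D"
  shows "{vertex (4 * n) (x + int n), vertex (4 * n) (y + int n)} \<in> D \<longleftrightarrow>
     {vertex (4 * n) x, vertex (4 * n) y} \<in> D"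
proof -
  let ?r = "\<lambda>z. cis (pi / 2) * z"
  have "inj ?r" by (intro injI) simp
  then have "?r ` d \<in> (\<lambda>d. ?r ` d) ` D \<longleftrightarrow> d \<in> D" for d by (auto simp: inj_image_eq_iff)
  then have "?r ` d \<in> D \<longleftrightarrow> d \<in> D" for d using inv unfolding quarter_turn_invariant_def by metis
  from this[of "{vertex (4 * n) x, vertex (4 * n) y}"] show ?thesis
    by (simp add: quarter_turn_vertex[OF n] del: cis_pi_half)
qed

lemma quarter_periodic_polygon:
  assumes n: "n \<ge> 1" and inv: "quarter_turn_invariant D"
  shows "quarter_periodic (int n) (\<lambda>x y. {vertex (4 * n) x, vertex (4 * n) y} \<in> D)"
proof
  show "{vertex (4 * n) (x + 4 * int n), vertex (4 * n) y} \<in> D \<longleftrightarrow> {vertex (4 * n) x, vertex (4 * n) y} \<in> D" for x y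
  proof -
    have "vertex (4 * n) (x + 4 * int n) = vertex (4 * n) x" using n by (subst vertex_eq_iff) auto
    then show ?thesis by simp
  qed
qed (use n quarter_turn_invariantD[OF assms] in \<open>auto simp: insert_commute\<close>)

lemma canonical_map_invariant:
  assumes n: "n \<ge> 1"
  shows "quarter_turn_invariant (canonical_map n T)"
proof -
  let ?r = "\<lambda>d. (\<lambda>z. cis (pi / 2) * z) ` d" and ?v = "vertex (4 * n)"
  have r: "?r {?v x, ?v y} = {?v (x + int n), ?v (y + int n)}" for x y
    by (simp add: quarter_turn_vertex[OF n] del: cis_pi_half)
  have shift: "{?v (x + l * int n), ?v (y + l * int n)} \<in> canonical_map n T"
    if "x < y" "proj_edge n {x, y} \<in> T" for x y l
    using that by (intro canonical_mapI) (auto simp: proj_edge_shift)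
  show ?thesis
    unfolding quarter_turn_invariant_def
  proof (intro set_eqI iffI)
    fix d assume "d \<in> ?r ` canonical_map n T"
    then obtain x y where "x < y" "proj_edge n {x, y} \<in> T" "d = ?r {?v x, ?v y}"
      by (auto elim: canonical_mapE)
    then show "d \<in> canonical_map n T" using shift[of x y 1] by (simp only: r mult_1_left)
  next
    fix d assume "d \<in> canonical_map n T"
    then obtain x y where *: "x < y" "proj_edge n {x, y} \<in> T" "d = {?v x, ?v y}"
      by (rule canonical_mapE)
    then have "d = ?r {?v (x - int n), ?v (y - int n)}" by (simp only: r diff_add_cancel)
    then show "d \<in> ?r ` canonical_map n T"
      by (rule image_eqI) (use shift[of x y "-1"] * in simp)
  qed
qed

text \<open>A side appears either as neighbouring indices or, across the end of the window, as
  indices \<open>int m - 1\<close> apart.\<close>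

lemma polygon_diagonals_iff:
  assumes m: "m > 0" and xy: "x < y" "y < x + int m"
  shows "{vertex m x, vertex m y} \<in> polygon_diagonals m \<longleftrightarrow> 2 \<le> y - x \<and> y - x \<le> int m - 2"
proof -
  have ne: "vertex m x \<noteq> vertex m y"
    using xy zdvd_imp_le[of "int m" "y - x"] by (auto simp: vertex_eq_iff[OF m] dvd_diff_commute)
  have "{vertex m x, vertex m y} \<in> polygon_sides m \<longleftrightarrow> y = x + 1 \<or> y = x + int m - 1"
  proof
    assume "{vertex m x, vertex m y} \<in> polygon_sides m"
    then obtain i where "{vertex m x, vertex m y} = {vertex m i, vertex m (i + 1)}"
      unfolding polygon_sides_def by blast
    then consider "int m dvd x - i" "int m dvd y - (i + 1)" | "int m dvd x - (i + 1)" "int m dvd y - i"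
      unfolding doubleton_eq_iff vertex_eq_iff[OF m] by blast
    then have "int m dvd y - x - 1 \<or> int m dvd y - x + 1"
    proof cases
      case 1
      then show ?thesis using dvd_diff[of "int m" "y - (i + 1)" "x - i"] by (simp add: algebra_simps)
    next
      case 2
      then show ?thesis using dvd_diff[of "int m" "y - i" "x - (i + 1)"] by (simp add: algebra_simps)
    qed
    then show "y = x + 1 \<or> y = x + int m - 1"
      using xy zdvd_imp_le[of "int m" "y - x - 1"] zdvd_imp_le[of "int m" "y - x + 1"] by linarith
  next
    assume "y = x + 1 \<or> y = x + int m - 1"
    then show "{vertex m x, vertex m y} \<in> polygon_sides m"
    proof
      assume "y = x + int m - 1"
      then have "vertex m (y + 1) = vertex m x" by (simp add: vertex_eq_iff[OF m])
      then show ?thesis unfolding polygon_sides_def by (auto intro!: exI[of _ y])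
    qed (auto simp: polygon_sides_def)
  qed
  then show ?thesis
    unfolding polygon_diagonals_def using ne xy by auto
qed

lemma canonical_map_diagonals:
  assumes n: "n \<ge> 1" and T: "T \<subseteq> short_cyl_edges n"
  shows "canonical_map n T \<subseteq> polygon_diagonals (4 * n)"
proof
  fix d assume "d \<in> canonical_map n T"
  then obtain x y where *: "x < y" "proj_edge n {x, y} \<in> T" "d = {vertex (4 * n) x, vertex (4 * n) y}"
    by (rule canonical_mapE)
  then have "2 \<le> y - x" "y - x \<le> 2 * int n" using short_cyl_edgesD[of n x y] T by auto
  with * n show "d \<in> polygon_diagonals (4 * n)" by (simp add: polygon_diagonals_iff)
qed

lemma diagonal_short_representation:
  assumes n: "n \<ge> 1" and d: "d \<in> polygon_diagonals (4 * n)"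
  shows "\<exists>x y. 2 \<le> y - x \<and> y - x \<le> 2 * int n \<and> d = {vertex (4 * n) x, vertex (4 * n) y}"
proof -
  have pos: "4 * n > 0" using n by simp
  from d obtain u w where "d = {u, w}" "u \<in> range (vertex (4 * n))" "w \<in> range (vertex (4 * n))" "u \<noteq> w"
    unfolding polygon_diagonals_def by blast
  with chord_pair_window[OF pos, of u w 0] obtain x y where
    xy: "0 \<le> x" "x < y" "y < 0 + int (4 * n)" "d = {vertex (4 * n) x, vertex (4 * n) y}" by metis
  with d have len: "2 \<le> y - x" "y - x \<le> int (4 * n) - 2"
    using polygon_diagonals_iff[OF pos, of x y] by auto
  show ?thesis
  proof (cases "y - x \<le> 2 * int n")
    case True
    with len xy show ?thesis by blast
  next
    case False
    \<comment> \<open>The long arc is replaced by the complementary one, from \<open>y\<close> to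
      \<open>x + 4 * int n\<close>.\<close>
    have "vertex (4 * n) (x + 4 * int n) = vertex (4 * n) x" using n by (subst vertex_eq_iff) auto
    with xy len False show ?thesis
      by (intro exI[of _ y] exI[of _ "x + 4 * int n"]) (auto simp: insert_commute)
  qed
qed

lemma canonical_map_onto:
  assumes n: "n \<ge> 1" and D: "D \<subseteq> polygon_diagonals (4 * n)" and inv: "quarter_turn_invariant D"
  shows "\<exists>T \<subseteq> short_cyl_edges n. canonical_map n T = D"
proof (intro exI conjI)
  let ?v = "vertex (4 * n)"
  define T where "T = {proj_edge n {x, y} | x y. 2 \<le> y - x \<and> y - x \<le> 2 * int n \<and> {?v x, ?v y} \<in> D}"
  show "T \<subseteq> short_cyl_edges n" unfolding T_def short_cyl_edges_def by blast
  show "canonical_map n T = D"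
  proof (intro set_eqI iffI)
    fix d assume "d \<in> canonical_map n T"
    then obtain x y where *: "x < y" "proj_edge n {x, y} \<in> T" "d = {?v x, ?v y}"
      by (rule canonical_mapE)
    then obtain x' y' where **: "proj_edge n {x', y'} = proj_edge n {x, y}" "2 \<le> y' - x'" "{?v x', ?v y'} \<in> D"
      unfolding T_def by auto
    \<comment> \<open>Membership in \<open>T\<close> only provides some representative in
      \<open>D\<close>; invariance of \<open>D\<close> carries this over to its translation
      \<open>{x, y}\<close>.\<close>
    then obtain l where "x = x' + l * int n" "y = y' + l * int n"
      using proj_edge_pair_eqD[OF **(1)] *(1) by auto
    then show "d \<in> D"
      using quarter_periodic.turn_int[OF quarter_periodic_polygon[OF n inv], of x' l y'] * ** by simp
  next
    fix d assume d: "d \<in> D"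
    with D diagonal_short_representation[OF n] obtain x y where
      "2 \<le> y - x" "y - x \<le> 2 * int n" "d = {?v x, ?v y}" by blast
    with d have "proj_edge n {x, y} \<in> T" "x < y" unfolding T_def by auto
    with \<open>d = _\<close> show "d \<in> canonical_map n T" using canonical_mapI by blast
  qed
qed

section \<open>Transfer of 3-crossings and of maximality\<close>

lemma cover_3_crossing_cong:
  assumes "\<And>x y. x < y \<Longrightarrow> P x y \<longleftrightarrow> Q x y"
  shows "cover_3_crossing P \<longleftrightarrow> cover_3_crossing Q"
proof -
  have *: "cover_3_crossing Q" if PQ: "\<And>x y. x < y \<Longrightarrow> P x y \<Longrightarrow> Q x y" and "cover_3_crossing P" for P Q
  proof -
    from that(2) obtain a1 a2 a3 b1 b2 b3 where "a1 < a2" "a2 < a3" "a3 < b1" "b1 < b2" "b2 < b3"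
      "P a1 b1" "P a2 b2" "P a3 b3" unfolding cover_3_crossing_def by blast
    then show ?thesis by (intro cover_3_crossingI[of Q a1 b1 a2 b2 a3 b3] PQ) auto
  qed
  show ?thesis using *[of P Q] *[of Q P] assms by blast
qed

text \<open>The lifts of \<open>T\<close> are exactly the short arcs of its image, so
  \<open>cover_3_crossing_iff\<close> applies.\<close>

lemma no_3_crossing_canonical_map_iff:
  assumes n: "n \<ge> 1" and T: "T \<subseteq> short_cyl_edges n"
  shows "no_3_crossing diagonals_intersect (canonical_map n T) \<longleftrightarrow>
    no_3_crossing cover_intersect (preimage_edges n T)"
proof -
  interpret quarter_periodic "int n" "\<lambda>x y. {vertex (4 * n) x, vertex (4 * n) y} \<in> canonical_map n T"
    by (rule quarter_periodic_polygon[OF n canonical_map_invariant[OF n]])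
  have "{x, y} \<in> preimage_edges n T \<longleftrightarrow> short x y" if "x < y" for x y
    using canonical_map_iff[OF n T that] short_cyl_edgesD[of n x y] T that
    by (auto simp: pair_in_preimage short_def)
  then have "cover_3_crossing (\<lambda>x y. {x, y} \<in> preimage_edges n T) \<longleftrightarrow> cover_3_crossing (\<lambda>x y. short x y)"
    by (rule cover_3_crossing_cong)
  then show ?thesis
    using no_3_crossing_polygon_iff[OF _ canonical_map_diagonals[OF n T]] n
    unfolding no_3_crossing_cover_iff[OF preimage_edges_subset] cover_3_crossing_iff by simp
qed

text \<open>Competitors may be restricted to short edges, since a longer edge already brings a
  3-crossing.\<close>

lemma cyl_2_triangulation_iff:
  assumes n: "n \<ge> 1"
  shows "cyl_2_triangulation n T \<longleftrightarrow>
    T \<subseteq> short_cyl_edges n \<and> no_3_crossing cover_intersect (preimage_edges n T) \<and>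
    (\<forall>U \<subseteq> short_cyl_edges n. no_3_crossing cover_intersect (preimage_edges n U) \<longrightarrow> T \<subseteq> U \<longrightarrow> U = T)"
  unfolding cyl_2_triangulation_def inclusion_maximal_def
  using no_3_crossing_imp_short[OF _ n] short_cyl_edges_subset[of n] by (meson subset_trans)

text \<open>This supplies the hypothesis \<open>maximal\<close> of \<open>addable_imp_edge\<close>:
  adding one edge of the half-cylinder adds a whole orbit of lifts.\<close>

lemma cyl_2_triangulation_adding_edge:
  assumes n: "n \<ge> 1" and T: "cyl_2_triangulation n T"
    and len: "2 \<le> b - a" "b - a \<le> 2 * int n" and new: "proj_edge n {a, b} \<notin> T"
  shows "cover_3_crossing (\<lambda>x y. {x, y} \<in> preimage_edges n T \<or> (\<exists>k. x = a + k * int n \<and> y = b + k * int n))"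
proof -
  define U where "U = insert (proj_edge n {a, b}) T"
  have "U \<subseteq> short_cyl_edges n"
    using T len unfolding cyl_2_triangulation_iff[OF n] U_def short_cyl_edges_def by blast
  moreover have "T \<subseteq> U" "U \<noteq> T" using new by (auto simp: U_def)
  ultimately have "\<not> no_3_crossing cover_intersect (preimage_edges n U)"
    using T unfolding cyl_2_triangulation_iff[OF n] by blast
  then have "cover_3_crossing (\<lambda>x y. {x, y} \<in> preimage_edges n U)"
    by (simp add: no_3_crossing_cover_iff preimage_edges_subset)
  also have "?this \<longleftrightarrow> ?thesis"
  proof (rule cover_3_crossing_cong)
    fix x y :: int assume "x < y"
    then show "{x, y} \<in> preimage_edges n U \<longleftrightarrow>
        {x, y} \<in> preimage_edges n T \<or> (\<exists>k. x = a + k * int n \<and> y = b + k * int n)"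
      using proj_edge_pair_eqD[of n a b x y] len
      by (auto simp: pair_in_preimage U_def proj_edge_shift)
  qed
  finally show ?thesis .
qed

lemma canonical_map_maximal:
  assumes n: "n \<ge> 1" and T: "cyl_2_triangulation n T"
  shows "polygon_2_triangulation (4 * n) (canonical_map n T)"
proof -
  let ?v = "vertex (4 * n)"
  let ?D = "canonical_map n T"
  have pos: "4 * n > 0" using n by simp
  have short_T: "T \<subseteq> short_cyl_edges n" and "no_3_crossing cover_intersect (preimage_edges n T)"
    using T by (auto simp: cyl_2_triangulation_iff[OF n])
  then have free: "no_3_crossing diagonals_intersect ?D"
    by (simp add: no_3_crossing_canonical_map_iff[OF n])
  interpret quarter_periodic "int n" "\<lambda>x y. {?v x, ?v y} \<in> ?D"
    by (rule quarter_periodic_polygon[OF n canonical_map_invariant[OF n]])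
  note D = canonical_map_diagonals[OF n short_T]
  have free': "\<not> polygon_3_crossing (4 * int n) (\<lambda>x y. {?v x, ?v y} \<in> ?D)"
    using free no_3_crossing_polygon_iff[OF pos D] by simp
  have maximal: "cover_3_crossing (\<lambda>x y. short x y \<or> (\<exists>k. x = a + k * int n \<and> y = b + k * int n))"
    if "2 \<le> b - a" "b - a \<le> 2 * int n" "{?v a, ?v b} \<notin> ?D" for a b
  proof -
    have "proj_edge n {a, b} \<notin> T" using that canonical_mapI[of n a b T] by auto
    from cyl_2_triangulation_adding_edge[OF n T that(1,2) this]
    show ?thesis
    proof (subst cover_3_crossing_cong)
      fix x y :: int assume "x < y"
      then show "short x y \<or> (\<exists>k. x = a + k * int n \<and> y = b + k * int n) \<longleftrightarrow>
          {x, y} \<in> preimage_edges n T \<or> (\<exists>k. x = a + k * int n \<and> y = b + k * int n)"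
        using canonical_map_iff[OF n short_T] short_cyl_edgesD[of n x y] short_T
        by (auto simp: pair_in_preimage short_def)
    qed
  qed
  have "U = ?D" if U: "U \<subseteq> polygon_diagonals (4 * n)" "no_3_crossing diagonals_intersect U" "?D \<subseteq> U" for U
  proof
    show "U \<subseteq> ?D"
    proof
      fix d assume d: "d \<in> U"
      with U diagonal_short_representation[OF n] obtain a b where
        ab: "2 \<le> b - a" "b - a \<le> 2 * int n" "d = {?v a, ?v b}" by blast
      have "\<not> polygon_3_crossing (int (4 * n)) (\<lambda>x y. {?v x, ?v y} \<in> U)"
        using U no_3_crossing_polygon_iff[OF pos] by blast
      \<comment> \<open>The competitor \<open>U\<close> need not be invariant. It contains
        \<open>?D\<close> and \<open>d\<close>, so two chords of \<open>?D\<close> crossing each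
        other and \<open>d\<close> would form a 3-crossing in \<open>U\<close>.\<close>
      then have "addable a b"
        unfolding addable_def polygon_3_crossing_def using U(3) d ab(3) by fastforce
      then have "{?v a, ?v b} \<in> ?D"
        using addable_imp_edge[OF free' maximal] ab by blast
      with ab show "d \<in> ?D" by simp
    qed
  qed (rule U(3))
  with D free show ?thesis
    unfolding polygon_2_triangulation_def inclusion_maximal_def by blast
qed

theorem theorem4p2:
  fixes n :: nat
  assumes "n \<ge> 1"
  shows "bij_betw (canonical_map n)
           {T. cyl_2_triangulation n T}
           {D. polygon_2_triangulation (4 * n) D \<and> quarter_turn_invariant D}"
  (is "bij_betw _ ?A ?B")
proof (rule bij_betw_imageI)
  show "inj_on (canonical_map n) ?A"
  proof (rule inj_onI)
    fix T U assume "T \<in> {T. cyl_2_triangulation n T}" "U \<in> {T. cyl_2_triangulation n T}"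
      "canonical_map n T = canonical_map n U"
    then show "T = U"
      using canonical_map_subset_iff[OF assms, of T U] canonical_map_subset_iff[OF assms, of U T]
      by (auto simp: cyl_2_triangulation_iff[OF assms])
  qed
next
  have "canonical_map n T \<in> ?B" if "T \<in> ?A" for T
    using that canonical_map_maximal[OF assms] canonical_map_invariant[OF assms] by auto
  \<comment> \<open>In this direction maximality passes over directly: a competitor of
    \<open>T\<close> is wrapped to a competitor of \<open>D\<close>.\<close>
  moreover have "D \<in> canonical_map n ` ?A" if "D \<in> ?B" for D
  proof -
    from that have D: "D \<subseteq> polygon_diagonals (4 * n)" "no_3_crossing diagonals_intersect D"
      "quarter_turn_invariant D"
      and maximal: "\<And>U. \<lbrakk>U \<subseteq> polygon_diagonals (4 * n); no_3_crossing diagonals_intersect U; D \<subseteq> U\<rbrakk> \<Longrightarrow> U = D"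
      by (auto simp: polygon_2_triangulation_def inclusion_maximal_def)
    from canonical_map_onto[OF assms D(1,3)] obtain T where
      T: "T \<subseteq> short_cyl_edges n" and TD: "canonical_map n T = D" by blast
    have "U = T" if U: "U \<subseteq> short_cyl_edges n" "no_3_crossing cover_intersect (preimage_edges n U)" "T \<subseteq> U" for U
    proof -
      have "canonical_map n U = D"
        using U TD canonical_map_subset_iff[OF assms T U(1)]
        by (intro maximal canonical_map_diagonals[OF assms]) (auto simp: no_3_crossing_canonical_map_iff[OF assms])
      then show "U = T"
        using canonical_map_subset_iff[OF assms U(1) T] TD U(3) by auto
    qed
    then have "cyl_2_triangulation n T"
      unfolding cyl_2_triangulation_iff[OF assms]
      using T D(2) TD no_3_crossing_canonical_map_iff[OF assms T] by blast
    with TD show ?thesis by blast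
  qed
  ultimately show "canonical_map n ` ?A = ?B" by blast
qed

end
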